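(* Let $(\mathfrak{g},[~,~],\alpha)$ be a (multiplicative) Hom-Lie algebra. Then the operation induced by the cup product bracket $[~,~]_{\mathsf{C}}$ on the cohomology $H^\bullet_{\mathrm{Hom}}(\mathfrak{g},\mathfrak{g})$ (with coefficients in the adjoint representation) is trivial; that is, for all $m,n\ge1$ and all cocycles $P\in C^m_{\mathrm{Hom}}(\mathfrak{g},\mathfrak{g})$, $Q\in C^n_{\mathrm{Hom}}(\mathfrak{g},\mathfrak{g})$ (i.e. $\delta_{\mathrm{Hom}}P=0=\delta_{\mathrm{Hom}}Q$), the class of $[P,Q]_{\mathsf{C}}$ in $H^{m+n}_{\mathrm{Hom}}(\mathfrak{g},\mathfrak{g})$ is zero.
   Context: All vector spaces and (multi)linear maps are over a field $\mathbf{k}$ of characteristic $0$. A (multiplicative) Hom-Lie algebra $(\mathfrak{g},[~,~],\alpha)$ is a vector space $\mathfrak{g}$ with a skew-symmetric bilinear map $[~,~]$ and a linear map $\alpha:\mathfrak{g}\to\mathfrak{g}$ such that $[\alpha(x),[y,z]]+[\alpha(y),[z,x]]+[\alpha(z),[x,y]]=0$ and $\alpha([x,y])=[\alpha(x),\alpha(y)]$. For $n\ge 1$, $C^n_{\mathrm{Hom}}(\mathfrak{g},\mathfrak{g})=\{f:\wedge^n\mathfrak{g}\to\mathfrak{g}\mid \alpha\circ f=f\circ\alpha^{\wedge n}\}$, and $C^0_{\mathrm{Hom}}(\mathfrak{g},\mathfrak{g})=\{v\in\mathfrak{g}\mid\alpha(v)=v\}$. The differential is $\delta_{\mathrm{Hom}}(v)(x)=[x,v]$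 on $C^0_{\mathrm{Hom}}$, and for $f\in C^n_{\mathrm{Hom}}(\mathfrak{g},\mathfrak{g})$, $n\ge1$, $$(\delta_{\mathrm{Hom}}f)(x_1,\ldots,x_{n+1})=\sum_{i=1}^{n+1}(-1)^{i+1}[\alpha^{n-1}(x_i),f(x_1,\ldots,\widehat{x_i},\ldots,x_{n+1})]+\sum_{i<j}(-1)^{i+j}f([x_i,x_j],\alpha(x_1),\ldots,\widehat{\alpha(x_i)},\ldots,\widehat{\alpha(x_j)},\ldots,\alpha(x_{n+1})).$$ $H^\bullet_{\mathrm{Hom}}(\mathfrak{g},\mathfrak{g})$ is the cohomology of this complex. With $Sh(m,n)$ the set of $(m,n)$-shuffles, the cup product bracket of $P\in C^m_{\mathrm{Hom}}(\mathfrak{g},\mathfrak{g})$ and $Q\in C^n_{\mathrm{Hom}}(\mathfrak{g},\mathfrak{g})$ ($m,n\ge1$) is $$[P,Q]_{\mathsf{C}}(x_1,\ldots,x_{m+n})=\sum_{\sigma\in Sh(m,n)}(-1)^\sigma[\alpha^{n-1}P(x_{\sigma(1)},\ldots,x_{\sigma(m)}),\alpha^{m-1}Q(x_{\sigma(m+1)},\ldots,x_{\sigma(m+n)})].$$ The differential $\delta_{\mathrm{Hom}}$ is a graded derivation of $[~,~]_{\mathsf{C}}$, so $[~,~]_{\mathsf{C}}$ induces an operation on cohomology. *)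

theory Defs
  imports Complex_Main "HOL-Combinatorics.Permutations" "HOL-Algebra.Coset"
begin

text \<open>
  A tuple \<open>(x\<^sub>1, \<dots>, x\<^sub>n)\<close> is represented by \<open>x :: nat \<Rightarrow> 'g\<close>, of which only the entries
  \<open>x 0, \<dots>, x (n - 1)\<close> matter; all indices are therefore shifted down by one.
\<close>

definition omit :: "nat \<Rightarrow> (nat \<Rightarrow> 'g) \<Rightarrow> nat \<Rightarrow> 'g" where
  "omit i x = (\<lambda>k. x (if k < i then k else Suc k))"

definition shuffle_perms :: "nat \<Rightarrow> nat \<Rightarrow> (nat \<Rightarrow> nat) set" where
  "shuffle_perms m n =
     {\<sigma>. \<sigma> permutes {..<m + n} \<and> strict_mono_on {..<m} \<sigma> \<and> strict_mono_on {m..<m + n} \<sigma>}"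

locale hom_lie_algebra = vector_space scale
  for scale :: "'k::field_char_0 \<Rightarrow> 'g::ab_group_add \<Rightarrow> 'g" +
  fixes bracket :: "'g \<Rightarrow> 'g \<Rightarrow> 'g" and \<alpha> :: "'g \<Rightarrow> 'g"
  assumes bracket_linear_left: "Vector_Spaces.linear scale scale (\<lambda>x. bracket x y)"
    and bracket_linear_right: "Vector_Spaces.linear scale scale (\<lambda>y. bracket x y)"
    and bracket_skew: "bracket x y = - bracket y x"
    and alpha_linear: "Vector_Spaces.linear scale scale \<alpha>"
    and hom_jacobi:
      "bracket (\<alpha> x) (bracket y z) + bracket (\<alpha> y) (bracket z x) + bracket (\<alpha> z) (bracket x y) = 0"
    and multiplicative: "\<alpha> (bracket x y) = bracket (\<alpha> x) (\<alpha> y)"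
begin

text \<open>
  Linear maps on the \<open>n\<close>-th exterior power are encoded as alternating \<open>n\<close>-linear maps. The first
  condition says that \<open>f\<close> is a function of the first \<open>n\<close> entries only, so that equality of functions
  is equality of \<open>n\<close>-cochains. For \<open>n = 0\<close> it makes \<open>f\<close> a constant \<open>v\<close>, and the last
  condition becomes \<open>\<alpha> v = v\<close>.
\<close>

definition cochains :: "nat \<Rightarrow> ((nat \<Rightarrow> 'g) \<Rightarrow> 'g) set" where
  "cochains n = {f.
     (\<forall>x y. (\<forall>i<n. x i = y i) \<longrightarrow> f x = f y) \<and>
     (\<forall>x. \<forall>i<n. Vector_Spaces.linear scale scale (\<lambda>v. f (x(i := v)))) \<and>
     (\<forall>x. \<forall>j<n. \<forall>i<j. x i = x j \<longrightarrow> f x = 0) \<and>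
     (\<forall>x. \<alpha> (f x) = f (\<alpha> \<circ> x))}"

text \<open>
  In \<open>differential n f\<close> the number \<open>n\<close> is the degree of \<open>f\<close>. For \<open>n = 0\<close> the truncated
  subtraction \<open>n - 1 = 0\<close> makes the formula agree with the separate definition in degree 0.
\<close>

definition differential :: "nat \<Rightarrow> ((nat \<Rightarrow> 'g) \<Rightarrow> 'g) \<Rightarrow> (nat \<Rightarrow> 'g) \<Rightarrow> 'g" where
  "differential n f x =
     (\<Sum>i\<le>n. scale ((-1) ^ i) (bracket ((\<alpha> ^^ (n - 1)) (x i)) (f (omit i x)))) +
     (\<Sum>j\<le>n. \<Sum>i<j. scale ((-1) ^ (i + j))
        (f (case_nat (bracket (x i) (x j)) (\<alpha> \<circ> omit i (omit j x)))))"

lemma differential_0: "differential 0 (\<lambda>_. v) x = bracket (x 0) v"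
  by (simp add: differential_def)

definition cocycles :: "nat \<Rightarrow> ((nat \<Rightarrow> 'g) \<Rightarrow> 'g) set" where
  "cocycles n = {f \<in> cochains n. differential n f = (\<lambda>_. 0)}"

definition coboundaries :: "nat \<Rightarrow> ((nat \<Rightarrow> 'g) \<Rightarrow> 'g) set" where
  "coboundaries n = (case n of 0 \<Rightarrow> {\<lambda>_. 0} | Suc k \<Rightarrow> differential k ` cochains k)"

definition cocycle_group :: "nat \<Rightarrow> ((nat \<Rightarrow> 'g) \<Rightarrow> 'g) monoid" where
  "cocycle_group n =
     \<lparr>carrier = cocycles n, monoid.mult = (\<lambda>f g x. f x + g x), one = (\<lambda>_. 0)\<rparr>"

definition cohomology :: "nat \<Rightarrow> ((nat \<Rightarrow> 'g) \<Rightarrow> 'g) set monoid" where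
  "cohomology n = cocycle_group n Mod coboundaries n"

definition cohomology_class :: "nat \<Rightarrow> ((nat \<Rightarrow> 'g) \<Rightarrow> 'g) \<Rightarrow> ((nat \<Rightarrow> 'g) \<Rightarrow> 'g) set" where
  "cohomology_class n f = coboundaries n #>\<^bsub>cocycle_group n\<^esub> f"

text \<open>Meaningful for cochains \<open>P\<close>, \<open>Q\<close> of degrees \<open>m, n \<ge> 1\<close>.\<close>

definition cup_bracket ::
  "nat \<Rightarrow> nat \<Rightarrow> ((nat \<Rightarrow> 'g) \<Rightarrow> 'g) \<Rightarrow> ((nat \<Rightarrow> 'g) \<Rightarrow> 'g) \<Rightarrow> (nat \<Rightarrow> 'g) \<Rightarrow> 'g" where
  "cup_bracket m n P Q x =
     (\<Sum>\<sigma>\<in>shuffle_perms m n. scale (of_int (sign \<sigma>))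
        (bracket ((\<alpha> ^^ (n - 1)) (P (\<lambda>i. x (\<sigma> i))))
                 ((\<alpha> ^^ (m - 1)) (Q (\<lambda>i. x (\<sigma> (m + i)))))))"

end

end

theory Submission
  imports Defs "HOL-Library.Infinite_Set"
begin

text \<open>
  Let \<open>P\<close> and \<open>Q\<close> be cocycles of degrees \<open>m = p + 1\<close> and \<open>n = q + 1\<close>. Substituting \<open>Q\<close> into \<open>P\<close>, with the
  remaining arguments twisted by \<open>\<alpha>\<^sup>q\<close> to match the twist \<open>[\<alpha>\<^sup>q x\<^sub>i, Q (\<dots>)]\<close> in \<open>\<delta>Q\<close>, gives the cochain
  \<open>R = \<Sum>\<^sub>\<sigma> (-1)\<^sup>\<sigma> P (Q (x\<^bsub>\<sigma> p\<^esub>, \<dots>), \<alpha>\<^sup>q x\<^bsub>\<sigma> 0\<^esub>, \<dots>)\<close> of degree \<open>m + n - 1\<close>, the Hom-version of the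
  Nijenhuis-Richardson composition. The differential fails to be a derivation of this composition, and
  the failure is exactly the cup product bracket: \<open>\<delta> R\<close> is a combination of \<open>\<delta>P\<close> with \<open>Q\<close> substituted,
  of \<open>P\<close> with \<open>\<delta>Q\<close> substituted, and of \<open>[P, Q]\<close>. For cocycles only the last one survives,
  so \<open>[P, Q]\<close> is a coboundary.

  All signs are handled by one operation: the \<open>alternation\<close> of \<open>F\<close> is the signed sum of
  \<open>F (x \<circ> \<sigma>)\<close> over all permutations \<open>\<sigma>\<close>. A permutation of the arguments of \<open>F\<close> only multiplies the
  alternation by a sign (\<open>alternation_permute\<close>), an inner alternation is absorbed by an outer one up to
  a factorial (\<open>alternation_absorb\<close>), and the signed sums with omitted entries in the differential,
  as well as the sum over shuffles in the bracket, are alternations up to factorials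
  (\<open>alternation_one_slot\<close>, \<open>alternation_two_slots\<close>, \<open>alternation_shuffle\<close>). Dividing by factorials is
  where characteristic 0 enters. After alternation all permuted copies of a term coincide up to sign, and
  only five expressions remain: with \<open>N = m + n\<close> and writing \<open>Q\<close> for \<open>Q (x\<^sub>m, \<dots>, x\<^bsub>N - 1\<^esub>)\<close>, they are
    \<^item> \<open>C = [\<alpha>\<^sup>p Q, P (\<alpha>\<^sup>q x\<^sub>0, \<dots>)]\<close>, the cup product bracket up to a constant;
    \<^item> \<open>V = [\<alpha>\<^bsup>p + q\<^esup> x\<^sub>0, P (Q, \<alpha>\<^sup>q x\<^sub>1, \<dots>)]\<close>;
    \<^item> \<open>U = P ([\<alpha>\<^sup>q x\<^sub>0, Q], \<alpha>\<^bsup>q + 1\<^esup> x\<^sub>1, \<dots>)\<close>;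
    \<^item> \<open>B = P (\<alpha> Q, \<alpha>\<^sup>q [x\<^sub>0, x\<^sub>1], \<alpha>\<^bsup>q + 1\<^esup> x\<^sub>2, \<dots>)\<close>;
    \<^item> \<open>A = P (Q ([x\<^sub>0, x\<^sub>m], \<alpha> x\<^bsub>m + 1\<^esub>, \<dots>), \<alpha>\<^bsup>q + 1\<^esup> x\<^sub>1, \<dots>)\<close>.

  Modulo alternation, closedness of \<open>P\<close> says \<open>2 p! C = m! (2 V - 2 U - p B)\<close>
  (\<open>alternation_P_closed\<close>), closedness of \<open>Q\<close> says \<open>2 U = n A\<close> (\<open>alternation_Q_closed\<close>), and expanding the
  differential of \<open>R\<close> gives \<open>2 \<delta> R = 2 V - p B - n A\<close> (\<open>differential_insertion\<close>). Hence the alternation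
  of \<open>C\<close> is \<open>m\<close> times \<open>\<delta> R\<close>; since it also equals \<open>- m! n! [P, Q]\<close>, the bracket is the differential of
  \<open>- R / (p! n!)\<close> (\<open>cup_bracket_eq_differential\<close>).
\<close>

section \<open>Permutations\<close>

text \<open>
  The cycle for which \<open>x \<circ> cycle_to_front i\<close> is the tuple \<open>x\<close> with its entry \<open>x i\<close> moved to the front.
\<close>

definition cycle_to_front :: "nat \<Rightarrow> nat \<Rightarrow> nat" where
  "cycle_to_front i k = (if k = 0 then i else if k \<le> i then k - 1 else k)"

definition shift_perm :: "nat \<Rightarrow> (nat \<Rightarrow> nat) \<Rightarrow> nat \<Rightarrow> nat" where
  "shift_perm s \<tau> k = (if k < s then k else s + \<tau> (k - s))"

lemma cycle_to_front_0: "cycle_to_front 0 = id"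
  by (auto simp: cycle_to_front_def)

lemma cycle_to_front_Suc: "cycle_to_front (Suc i) = transpose i (Suc i) \<circ> cycle_to_front i"
  by (auto simp: cycle_to_front_def transpose_def fun_eq_iff)

lemma cycle_to_front_permutes: "i < N \<Longrightarrow> cycle_to_front i permutes {..<N}"
  by (induction i)
    (auto simp: cycle_to_front_0 cycle_to_front_Suc intro!: permutes_compose permutes_swap_id permutes_id)

lemma sign_cycle_to_front: "sign (cycle_to_front i) = (-1) ^ i"
proof (induction i)
  case (Suc i)
  have "permutation (cycle_to_front i)"
    using cycle_to_front_permutes[of i "Suc i"] by (auto simp: permutation_permutes)
  then show ?case
    unfolding cycle_to_front_Suc
    by (subst sign_compose) (use Suc in \<open>simp_all add: permutation_swap_id sign_swap_id\<close>)
qed (simp add: cycle_to_front_0 sign_id)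

lemma shift_perm_eq_map_permutation:
  assumes "\<tau> permutes {..<k}"
  shows "shift_perm s \<tau> = map_permutation {..<k} ((+) s) \<tau>"
proof
  fix j
  have im: "(+) s ` {..<k} = {s..<s + k}"
    by (simp add: lessThan_atLeast0 add.commute)
  show "shift_perm s \<tau> j = map_permutation {..<k} ((+) s) \<tau> j"
  proof (cases "j \<in> {s..<s + k}")
    case True
    then obtain l where l: "j = s + l" "l < k" by (auto simp: nat_le_iff_add)
    have "map_permutation {..<k} ((+) s) \<tau> (s + l) = s + \<tau> l"
      using l by (intro map_permutation_apply) auto
    then show ?thesis using l by (simp add: shift_perm_def)
  next
    case False
    moreover have "\<tau> (j - s) = j - s" if "s + k \<le> j"
      using that assms by (intro permutes_not_in[OF assms]) auto
    ultimately show ?thesis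
      by (auto simp: map_permutation_def im restrict_id_def shift_perm_def)
  qed
qed

lemma shift_perm_permutes:
  assumes "\<tau> permutes {..<k}"
  shows "shift_perm s \<tau> permutes {s..<s + k}"
  unfolding shift_perm_eq_map_permutation[OF assms]
proof (rule map_permutation_permutes[OF _ assms])
  show "bij_betw ((+) s) {..<k} {s..<s + k}"
    by (simp add: bij_betw_def lessThan_atLeast0 add.commute)
qed

lemma sign_shift_perm:
  assumes "\<tau> permutes {..<k}"
  shows "sign (shift_perm s \<tau>) = sign \<tau>"
  unfolding shift_perm_eq_map_permutation[OF assms]
  by (rule sign_map_permutation[OF _ assms]) auto

lemma sign_compose_permutes:
  assumes "\<sigma> permutes A" "\<tau> permutes B" "finite A" "finite B"
  shows "sign (\<sigma> \<circ> \<tau>) = sign \<sigma> * sign \<tau>"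
  using assms by (intro sign_compose) (auto simp: permutation_permutes)

lemma of_int_sign_sign [simp]: "of_int (sign \<sigma>) * of_int (sign \<sigma>) = (1 :: 'a::ring_1)"
  by (simp flip: of_int_mult)

lemma card_permutes_lessThan: "card {\<sigma>. \<sigma> permutes {..<n}} = fact n"
  by (rule card_permutations) auto

lemma finite_permutes_lessThan: "finite {\<sigma>. \<sigma> permutes {..<n::nat}}"
  by (rule finite_permutations) auto

text \<open>
  The decomposition behind the Laplace expansion along the first entry: a permutation is determined by the
  image \<open>i\<close> of \<open>0\<close> and by what it does to the rest. Injectivity is elementary, and both sides have
  \<open>(n + 1)!\<close> elements.
\<close>

lemma bij_betw_position_of_0:
  "bij_betw (\<lambda>(i, \<tau>). cycle_to_front i \<circ> shift_perm 1 \<tau>)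
     ({..n} \<times> {\<tau>. \<tau> permutes {..<n}}) {\<sigma>. \<sigma> permutes {..<Suc n}}" (is "bij_betw ?f ?A ?B")
proof -
  have inj: "inj_on ?f ?A"
  proof (rule inj_onI, clarify)
    fix i \<tau> i' \<tau>'
    assume i: "i \<le> n" "i' \<le> n"
      and eq: "cycle_to_front i \<circ> shift_perm 1 \<tau> = cycle_to_front i' \<circ> shift_perm 1 \<tau>'"
    have ii: "i = i'"
      using fun_cong[OF eq, of 0] by (simp add: cycle_to_front_def shift_perm_def)
    have "inj (cycle_to_front i)"
      using permutes_inj[OF cycle_to_front_permutes[of i "Suc i"]] by simp
    then have sh: "shift_perm 1 \<tau> = shift_perm 1 \<tau>'"
      using eq ii by (simp add: fun.inj_map_strong inj_eq fun_eq_iff)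
    have "\<tau> k = \<tau>' k" for k
      using fun_cong[OF sh, of "Suc k"] by (simp add: shift_perm_def)
    then show "i = i' \<and> \<tau> = \<tau>'" using ii by auto
  qed
  have sub: "?f ` ?A \<subseteq> ?B"
  proof clarify
    fix i \<tau> assume "i \<le> n" and t: "\<tau> permutes {..<n}"
    then show "(cycle_to_front i \<circ> shift_perm 1 \<tau>) permutes {..<Suc n}"
      by (intro permutes_compose cycle_to_front_permutes permutes_subset[OF shift_perm_permutes[OF t]]) auto
  qed
  have "card ?A = card ?B"
    using card_permutations[of "{..<Suc n}" "Suc n"] by (simp add: card_cartesian_product card_permutes_lessThan)
  then have "?f ` ?A = ?B"
    using inj sub by (intro card_subset_eq) (auto simp: card_image finite_permutes_lessThan)
  with inj show ?thesis by (auto simp: bij_betw_def)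
qed

lemma strict_mono_on_same_image:
  fixes f g :: "nat \<Rightarrow> nat"
  assumes "strict_mono_on {a..<b} f" "strict_mono_on {a..<b} g"
    and "f ` {a..<b} = g ` {a..<b}" and "k \<in> {a..<b}"
  shows "f k = g k"
proof -
  have "map f [a..<b] = map g [a..<b]"
  proof (rule sorted_distinct_set_unique)
    show "sorted (map f [a..<b])" "sorted (map g [a..<b])"
      using strict_mono_on_imp_mono_on[OF assms(1)] strict_mono_on_imp_mono_on[OF assms(2)]
      by (auto simp: sorted_iff_nth_mono monotone_on_def)
    show "distinct (map f [a..<b])" "distinct (map g [a..<b])"
      using strict_mono_on_imp_inj_on[OF assms(1)] strict_mono_on_imp_inj_on[OF assms(2)]
      by (auto simp: distinct_map)
  qed (use assms in auto)
  then show ?thesis using assms(4) by (simp add: map_eq_conv)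
qed

text \<open>
  Compare \<open>f\<close> with the increasing enumeration of its finite image.
\<close>

lemma ex_sorting_permutation:
  fixes f :: "nat \<Rightarrow> nat"
  assumes "inj_on f {a..<b}"
  obtains \<tau> where "\<tau> permutes {a..<b}" "strict_mono_on {a..<b} (f \<circ> \<tau>)"
proof -
  let ?I = "{a..<b}"
  have card: "card (f ` ?I) = b - a" using assms by (simp add: card_image)
  obtain h where h: "bij_betw h {..<b - a} (f ` ?I)" "strict_mono_on {..<b - a} h"
    using ex_bij_betw_strict_mono_card[of "f ` ?I"] unfolding card by auto
  define \<tau> where "\<tau> k = (if k \<in> ?I then inv_into ?I f (h (k - a)) else k)" for k
  have h_in: "h (k - a) \<in> f ` ?I" if "k \<in> ?I" for k
    using that h(1) by (auto simp: bij_betw_def)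
  have f\<tau>: "f (\<tau> k) = h (k - a)" if "k \<in> ?I" for k
    using that h_in[OF that] by (simp add: \<tau>_def f_inv_into_f)
  have mono: "strict_mono_on ?I (f \<circ> \<tau>)"
    using h(2) by (auto simp: f\<tau> strict_mono_on_def intro!: diff_less_mono)
  have "\<tau> ` ?I \<subseteq> ?I"
    using inv_into_into[OF h_in] by (simp add: \<tau>_def image_subset_iff del: atLeastLessThan_iff)
  moreover have "inj_on \<tau> ?I"
    using strict_mono_on_imp_inj_on[OF mono] by (auto dest: inj_on_imageI2)
  ultimately have "bij_betw \<tau> ?I ?I"
    using endo_inj_surj[of ?I \<tau>] by (simp add: bij_betw_def)
  then have "\<tau> permutes ?I"
    by (rule bij_imp_permutes) (auto simp: \<tau>_def)
  then show thesis using mono by (rule that)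
qed

text \<open>
  Shuffles represent the cosets of the permutations that preserve the two blocks: sorting the values of
  a permutation within each block turns it into a shuffle, and a shuffle is determined by the images
  of the two blocks.
\<close>

lemma bij_betw_shuffles_times_blocks:
  "bij_betw (\<lambda>(\<sigma>, \<tau>, \<rho>). \<sigma> \<circ> (\<tau> \<circ> shift_perm m \<rho>))
     (shuffle_perms m n \<times> {\<tau>. \<tau> permutes {..<m}} \<times> {\<rho>. \<rho> permutes {..<n}})
     {\<pi>. \<pi> permutes {..<m + n}}" (is "bij_betw ?f ?A ?B")
proof (rule bij_betw_imageI)
  show "inj_on ?f ?A"
  proof (rule inj_onI)
    fix u v assume uv: "u \<in> ?A" "v \<in> ?A" "?f u = ?f v"
    obtain \<sigma> \<tau> \<rho> \<sigma>' \<tau>' \<rho>' where u: "u = (\<sigma>, \<tau>, \<rho>)" and v: "v = (\<sigma>', \<tau>', \<rho>')"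
      by (metis prod_cases3)
    from uv have s: "\<sigma> \<in> shuffle_perms m n" "\<sigma>' \<in> shuffle_perms m n"
      and t: "\<tau> permutes {..<m}" "\<tau>' permutes {..<m}"
      and r: "\<rho> permutes {..<n}" "\<rho>' permutes {..<n}"
      and eq: "\<sigma> \<circ> (\<tau> \<circ> shift_perm m \<rho>) = \<sigma>' \<circ> (\<tau>' \<circ> shift_perm m \<rho>')"
      unfolding u v by auto
    have low: "(\<upsilon> \<circ> shift_perm m \<chi>) ` {..<m} = {..<m}" and
         high: "(\<upsilon> \<circ> shift_perm m \<chi>) ` {m..<m+n} = {m..<m+n}"
      if u: "\<upsilon> permutes {..<m}" and c: "\<chi> permutes {..<n}" for \<upsilon> \<chi>
    proof -
      have "shift_perm m \<chi> ` {..<m} = {..<m}" by (auto simp: shift_perm_def image_iff)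
      then show "(\<upsilon> \<circ> shift_perm m \<chi>) ` {..<m} = {..<m}"
        by (metis image_comp permutes_image u)
      have "\<upsilon> ` {m..<m+n} = {m..<m+n}"
        using permutes_not_in[OF u] by (auto simp: image_iff)
      then show "(\<upsilon> \<circ> shift_perm m \<chi>) ` {m..<m+n} = {m..<m+n}"
        by (metis image_comp permutes_image shift_perm_permutes c)
    qed
    have "\<sigma> ` {..<m} = \<sigma>' ` {..<m}" "\<sigma> ` {m..<m+n} = \<sigma>' ` {m..<m+n}"
      by (metis eq image_comp low r t) (metis eq image_comp high r t)
    then have "\<sigma> k = \<sigma>' k" if "k \<in> {0..<m} \<or> k \<in> {m..<m+n}" for k
      using that strict_mono_on_same_image[of 0 m \<sigma> \<sigma>' k]
        strict_mono_on_same_image[of m "m+n" \<sigma> \<sigma>' k] s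
      by (auto simp: shuffle_perms_def atLeast0LessThan)
    moreover have "\<sigma> k = \<sigma>' k" if "k \<ge> m + n" for k
      using that s by (auto simp: shuffle_perms_def permutes_not_in)
    ultimately have ss: "\<sigma> = \<sigma>'" by (metis atLeastLessThan_iff linorder_not_less ext zero_le)
    have "inj \<sigma>" using s by (auto simp: shuffle_perms_def permutes_inj)
    then have *: "\<tau> (shift_perm m \<rho> k) = \<tau>' (shift_perm m \<rho>' k)" for k
      using fun_cong[OF eq, of k] ss by (auto simp: inj_eq)
    have tt: "\<tau> = \<tau>'"
    proof
      fix k show "\<tau> k = \<tau>' k"
        using *[of k] t by (cases "k < m") (auto simp: shift_perm_def permutes_not_in)
    qed
    have "inj \<tau>'" using t by (auto simp: permutes_inj)
    then have "shift_perm m \<rho> k = shift_perm m \<rho>' k" for k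
      using *[of k] tt by (auto simp: inj_eq)
    from this[of "m + _"] have "\<rho> = \<rho>'" by (auto simp: shift_perm_def)
    then show "u = v" unfolding u v using ss tt by simp
  qed
  show "?f ` ?A = ?B"
  proof (rule equalityI)
    show "?f ` ?A \<subseteq> ?B"
    proof clarify
      fix \<sigma> \<tau> \<rho> assume "\<sigma> \<in> shuffle_perms m n" "\<tau> permutes {..<m}" "\<rho> permutes {..<n}"
      then show "(\<sigma> \<circ> (\<tau> \<circ> shift_perm m \<rho>)) permutes {..<m + n}"
        by (intro permutes_compose) (auto simp: shuffle_perms_def
           intro: permutes_subset permutes_subset[OF shift_perm_permutes])
    qed
  next
    show "?B \<subseteq> ?f ` ?A"
    proof
      fix \<pi> assume "\<pi> \<in> ?B"
      then have pi: "\<pi> permutes {..<m+n}" by simp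
      have inj: "inj_on \<pi> S" for S using permutes_inj[OF pi] by (auto intro: inj_on_subset)
      obtain \<tau> where t: "\<tau> permutes {0..<m}" "strict_mono_on {0..<m} (\<pi> \<circ> \<tau>)"
        by (rule ex_sorting_permutation[OF inj])
      obtain \<rho> where r: "\<rho> permutes {m..<m+n}" "strict_mono_on {m..<m+n} (\<pi> \<circ> \<rho>)"
        by (rule ex_sorting_permutation[OF inj])
      define \<sigma> where "\<sigma> = \<pi> \<circ> \<rho> \<circ> \<tau>"
      \<comment> \<open>The inverse of \<open>\<rho>\<close>, read as a permutation of \<open>{..<n}\<close>.\<close>
      define \<chi> where "\<chi> k = inv_into UNIV \<rho> (m + k) - m" for k
      have ir: "inv_into UNIV \<rho> permutes {m..<m+n}" using r by (intro permutes_inv)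
      have ir_ge: "inv_into UNIV \<rho> k \<ge> m \<longleftrightarrow> k \<ge> m" for k
        using permutes_in_image[OF ir, of k] permutes_not_in[OF ir, of k] by (cases "k < m + n") auto
      have sh: "shift_perm m \<chi> = inv_into UNIV \<rho>"
      proof
        fix k show "shift_perm m \<chi> k = inv_into UNIV \<rho> k"
          using ir_ge[of k] permutes_not_in[OF ir, of k] by (auto simp: shift_perm_def \<chi>_def)
      qed
      have chi: "\<chi> permutes {..<n}"
      proof (rule bij_imp_permutes)
        show "bij_betw \<chi> {..<n} {..<n}"
        proof (rule bij_betw_imageI)
          show inj': "inj_on \<chi> {..<n}"
          proof (rule inj_onI)
            fix a b assume "\<chi> a = \<chi> b"
            then have "inv_into UNIV \<rho> (m + a) = inv_into UNIV \<rho> (m + b)"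
              using ir_ge[of "m + a"] ir_ge[of "m + b"] by (simp add: \<chi>_def)
            then show "a = b" using permutes_inj[OF ir] by (auto simp: inj_eq)
          qed
          have "\<chi> ` {..<n} \<subseteq> {..<n}"
          proof (rule image_subsetI)
            fix k assume "k \<in> {..<n}"
            then have "inv_into UNIV \<rho> (m + k) \<in> {m..<m+n}" using permutes_in_image[OF ir, of "m + k"] by auto
            then show "\<chi> k \<in> {..<n}" by (auto simp: \<chi>_def)
          qed
          then show "\<chi> ` {..<n} = {..<n}" using inj' by (intro endo_inj_surj) auto
        qed
      qed (use permutes_not_in[OF ir] in \<open>auto simp: \<chi>_def\<close>)
      have t': "\<tau> permutes {..<m}" using t by (simp add: atLeast0LessThan)
      have "\<sigma> permutes {..<m+n}"
        unfolding \<sigma>_def by (intro permutes_compose pi permutes_subset[OF r(1)] permutes_subset[OF t(1)]) auto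
      moreover have "strict_mono_on {..<m} \<sigma>"
      proof -
        have "\<sigma> k = (\<pi> \<circ> \<tau>) k" if "k < m" for k
          using that permutes_in_image[OF t', of k] permutes_not_in[OF r(1), of "\<tau> k"] by (auto simp: \<sigma>_def)
        then show ?thesis using t(2) by (auto simp: strict_mono_on_def)
      qed
      moreover have "strict_mono_on {m..<m+n} \<sigma>"
      proof -
        have "\<sigma> k = (\<pi> \<circ> \<rho>) k" if "k \<ge> m" for k
          using that permutes_not_in[OF t', of k] by (auto simp: \<sigma>_def)
        then show ?thesis using r(2) by (auto simp: strict_mono_on_def)
      qed
      ultimately have "\<sigma> \<in> shuffle_perms m n" by (auto simp: shuffle_perms_def)
      moreover have "\<pi> = \<sigma> \<circ> (inv_into UNIV \<tau> \<circ> shift_perm m \<chi>)"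
        unfolding sh \<sigma>_def using permutes_inverses[OF t(1)] permutes_inverses[OF r(1)] by (auto simp: fun_eq_iff)
      ultimately show "\<pi> \<in> ?f ` ?A"
        using chi permutes_inv[OF t'] by (intro image_eqI[of _ _ "(\<sigma>, inv_into UNIV \<tau>, \<chi>)"]) auto
    qed
  qed
qed

section \<open>Alternation\<close>

locale char_0_vector_space = vector_space scale
  for scale :: "'k::field_char_0 \<Rightarrow> 'b::ab_group_add \<Rightarrow> 'b"
begin

definition alternation :: "nat \<Rightarrow> ((nat \<Rightarrow> 'c) \<Rightarrow> 'b) \<Rightarrow> (nat \<Rightarrow> 'c) \<Rightarrow> 'b" where
  "alternation N F x = (\<Sum>\<sigma> | \<sigma> permutes {..<N}. scale (of_int (sign \<sigma>)) (F (x \<circ> \<sigma>)))"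

text \<open>
  Sign change under permutations, without linearity; in this form the property also makes sense for expressions
  in which some entries are held fixed or twisted.
\<close>

definition skew :: "nat \<Rightarrow> ((nat \<Rightarrow> 'c) \<Rightarrow> 'b) \<Rightarrow> bool" where
  "skew n f \<longleftrightarrow> (\<forall>\<sigma> x. \<sigma> permutes {..<n} \<longrightarrow> f (x \<circ> \<sigma>) = scale (of_int (sign \<sigma>)) (f x))"

lemma skewD: "skew n f \<Longrightarrow> \<sigma> permutes {..<n} \<Longrightarrow> f (x \<circ> \<sigma>) = scale (of_int (sign \<sigma>)) (f x)"
  by (simp add: skew_def)

lemma scale_sign_sign [simp]:
  "scale (of_int (sign \<sigma>)) (scale (of_int (sign \<sigma>)) v) = v"
  by (simp flip: of_int_mult)

lemma alternation_scale: "alternation N (\<lambda>x. scale c (F x)) x = scale c (alternation N F x)"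
  by (simp add: alternation_def scale_sum_right mult.commute)

lemma alternation_minus: "alternation N (\<lambda>x. - F x) x = - alternation N F x"
  by (simp add: alternation_def sum_negf)

lemma alternation_diff: "alternation N (\<lambda>x. F x - G x) x = alternation N F x - alternation N G x"
  by (simp add: alternation_def scale_right_diff_distrib sum_subtractf)

lemma alternation_sum: "alternation N (\<lambda>x. \<Sum>i\<in>I. F i x) x = (\<Sum>i\<in>I. alternation N (F i) x)"
  unfolding alternation_def scale_sum_right by (rule sum.swap)

lemma alternation_zero: "alternation N (\<lambda>x. 0) x = 0"
  by (simp add: alternation_def)

text \<open>
  Reindex the sum over \<open>\<sigma>\<close> by \<open>\<tau> \<circ> \<sigma>\<close>. In contrast, \<open>alternation_permute\<close> below permutes the arguments inside
  the alternated expression and uses \<open>\<sigma> \<circ> \<tau>\<close>.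
\<close>

lemma skew_alternation: "skew N (alternation N F)"
  unfolding skew_def
proof (intro allI impI)
  fix \<tau> x assume t: "\<tau> permutes {..<N}"
  have "alternation N F x = (\<Sum>\<sigma> | \<sigma> permutes {..<N}. scale (of_int (sign (\<tau> \<circ> \<sigma>))) (F (x \<circ> (\<tau> \<circ> \<sigma>))))"
    unfolding alternation_def by (rule setum_permutations_compose_left[OF t])
  also have "\<dots> = (\<Sum>\<sigma> | \<sigma> permutes {..<N}. scale (of_int (sign \<tau>)) (scale (of_int (sign \<sigma>)) (F (x \<circ> \<tau> \<circ> \<sigma>))))"
    using t by (intro sum.cong) (simp_all add: sign_compose_permutes[OF t] o_assoc)
  finally show "alternation N F (x \<circ> \<tau>) = scale (of_int (sign \<tau>)) (alternation N F x)"
    by (simp only: scale_sum_right[symmetric] scale_sign_sign alternation_def[symmetric])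
qed

lemma alternation_permute:
  assumes t: "\<tau> permutes {..<N}"
  shows "alternation N (\<lambda>x. F (x \<circ> \<tau>)) x = scale (of_int (sign \<tau>)) (alternation N F x)"
proof -
  have "alternation N F x = (\<Sum>\<sigma> | \<sigma> permutes {..<N}. scale (of_int (sign (\<sigma> \<circ> \<tau>))) (F (x \<circ> (\<sigma> \<circ> \<tau>))))"
    unfolding alternation_def by (rule sum_permutations_compose_right[OF t])
  also have "\<dots> = (\<Sum>\<sigma> | \<sigma> permutes {..<N}. scale (of_int (sign \<tau>)) (scale (of_int (sign \<sigma>)) (F (x \<circ> \<sigma> \<circ> \<tau>))))"
    using t by (intro sum.cong) (simp_all add: sign_compose_permutes[OF _ t] o_assoc mult.commute)
  finally have "alternation N F x = scale (of_int (sign \<tau>)) (alternation N (\<lambda>x. F (x \<circ> \<tau>)) x)"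
    by (simp only: scale_sum_right[symmetric] alternation_def)
  then show ?thesis by simp
qed

text \<open>
  Each summand of the inner signed sum contributes the same alternation, because the sign of the
  permutation cancels the sign produced by \<open>alternation_permute\<close>. Here \<open>h\<close> embeds the small
  symmetric group into the large one.
\<close>

lemma alternation_absorb:
  assumes "\<And>\<tau>. \<tau> permutes {..<k} \<Longrightarrow> h \<tau> permutes {..<N}"
    and "\<And>\<tau>. \<tau> permutes {..<k} \<Longrightarrow> sign (h \<tau>) = sign \<tau>"
  shows "alternation N (\<lambda>x. \<Sum>\<tau> | \<tau> permutes {..<k}. scale (of_int (sign \<tau>)) (F (x \<circ> h \<tau>))) x
    = scale (fact k) (alternation N F x)"
proof -
  have "alternation N (\<lambda>x. \<Sum>\<tau> | \<tau> permutes {..<k}. scale (of_int (sign \<tau>)) (F (x \<circ> h \<tau>))) x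
    = (\<Sum>\<tau> | \<tau> permutes {..<k}. alternation N F x)"
    unfolding alternation_sum alternation_scale
    using assms by (intro sum.cong) (auto simp: alternation_permute simp flip: assms(2))
  then show ?thesis by (simp add: sum_constant_scale card_permutes_lessThan)
qed

lemma compose_cycle_shift:
  "x \<circ> (cycle_to_front i \<circ> shift_perm 1 \<tau>) = case_nat (x i) (omit i x \<circ> \<tau>)"
  by (auto simp: fun_eq_iff shift_perm_def omit_def cycle_to_front_def split: nat.split)

text \<open>
  Laplace expansion: group the permutations by the entry that they bring to the front.
\<close>

lemma alternation_Suc:
  "alternation (Suc n) F x =
    (\<Sum>i\<le>n. scale ((-1) ^ i) (alternation n (\<lambda>y. F (case_nat (x i) y)) (omit i x)))"
proof -
  have "alternation (Suc n) F x = (\<Sum>(i, \<tau>)\<in>{..n} \<times> {\<tau>. \<tau> permutes {..<n}}.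
      scale (of_int (sign (cycle_to_front i \<circ> shift_perm 1 \<tau>))) (F (x \<circ> (cycle_to_front i \<circ> shift_perm 1 \<tau>))))"
    unfolding alternation_def
    by (subst sum.reindex_bij_betw[OF bij_betw_position_of_0, symmetric]) (simp add: case_prod_beta)
  also have "\<dots> = (\<Sum>i\<le>n. \<Sum>\<tau> | \<tau> permutes {..<n}.
      scale ((-1) ^ i) (scale (of_int (sign \<tau>)) (F (case_nat (x i) (omit i x \<circ> \<tau>)))))"
    unfolding sum.cartesian_product[symmetric]
  proof (intro sum.cong refl)
    fix i \<tau> assume i: "i \<in> {..n}" and t: "\<tau> \<in> {\<tau>. \<tau> permutes {..<n}}"
    have "sign (cycle_to_front i \<circ> shift_perm 1 \<tau>) = (-1) ^ i * sign \<tau>"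
      using t i sign_compose_permutes[OF cycle_to_front_permutes[of i "Suc n"] shift_perm_permutes[of \<tau> n 1]]
      by (simp add: sign_cycle_to_front sign_shift_perm)
    then show "scale (of_int (sign (cycle_to_front i \<circ> shift_perm 1 \<tau>))) (F (x \<circ> (cycle_to_front i \<circ> shift_perm 1 \<tau>)))
      = scale ((-1) ^ i) (scale (of_int (sign \<tau>)) (F (case_nat (x i) (omit i x \<circ> \<tau>))))"
      unfolding compose_cycle_shift by simp
  qed
  finally show ?thesis by (simp add: alternation_def scale_sum_right)
qed

lemma alternation_of_skew:
  assumes "skew n f"
  shows "alternation n f x = scale (fact n) (f x)"
  by (simp add: alternation_def skewD[OF assms] sum_constant_scale card_permutes_lessThan)

text \<open>
  The first sum in the differential has this shape: \<open>G\<close> treats one distinguished entry specially and is skew in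
  the others, so the inner alternations in the Laplace expansion all collapse to factorials.
\<close>

lemma alternation_one_slot:
  assumes "\<And>v. skew n (G v)"
  shows "alternation (Suc n) (\<lambda>y. G (y 0) (y \<circ> Suc)) x =
    scale (fact n) (\<Sum>i\<le>n. scale ((-1) ^ i) (G (x i) (omit i x)))"
proof -
  have "(\<lambda>y. G (case_nat v y 0) (case_nat v y \<circ> Suc)) = G v" for v
    by (simp add: comp_def)
  then show ?thesis
    by (simp add: alternation_Suc alternation_of_skew[OF assms] scale_sum_right mult.commute del: comp_apply)
qed

text \<open>
  The second sum in the differential has this shape. Expanding twice gives a sum over ordered pairs of
  distinct entries; the factor 2 comes from the two orders of a pair, which agree because \<open>H\<close> is
  skew in its two distinguished entries, and the sign from the pair \<open>(0, 1)\<close> having \<open>(-1)\<^bsup>0 + 1\<^esup> = -1\<close>.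
\<close>

lemma alternation_two_slots:
  assumes skew: "\<And>v w. skew n (H v w)" and swap: "\<And>v w y. H v w y = - H w v y"
  shows "alternation (Suc (Suc n)) (\<lambda>y. H (y 0) (y 1) (y \<circ> Suc \<circ> Suc)) x =
    - scale (2 * fact n) (\<Sum>j\<le>Suc n. \<Sum>i<j. scale ((-1) ^ (i + j)) (H (x i) (x j) (omit i (omit j x))))"
proof -
  define T where "T i j = scale ((-1) ^ (i + j)) (H (x i) (x j) (omit i (omit j x)))" for i j
  define S where "S a b = scale ((-1) ^ a) (scale ((-1) ^ b) (H (x a) (omit a x b) (omit b (omit a x))))" for a b
  have inner: "alternation (Suc n) (\<lambda>y. H (case_nat v y 0) (case_nat v y 1) (case_nat v y \<circ> Suc \<circ> Suc)) y
     = scale (fact n) (\<Sum>b\<le>n. scale ((-1) ^ b) (H v (y b) (omit b y)))" for v y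
    using alternation_one_slot[of n "H v" y] skew by (simp add: comp_def)
  \<comment> \<open>\<open>b\<close> counts positions after \<open>a\<close> has been removed, so the second entry has index \<open>b\<close> or \<open>b + 1\<close>.\<close>
  have low: "S a b = - T b a" if "b < a" for a b
    using that swap[of "x a" "x b"] by (simp add: S_def T_def omit_def power_add mult.commute)
  have high: "S a b = - T a (Suc b)" if "a \<le> b" for a b
  proof -
    have "omit b (omit a x) = omit a (omit (Suc b) x)"
      using that by (auto simp: omit_def fun_eq_iff)
    then show ?thesis using that by (simp add: S_def T_def omit_def power_add)
  qed
  have "(\<Sum>a\<le>Suc n. \<Sum>b\<le>n. S a b) = (\<Sum>a\<le>Suc n. \<Sum>b<a. S a b) + (\<Sum>a\<le>n. \<Sum>b\<in>{a..n}. S a b)"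
  proof -
    have "(\<Sum>b\<le>n. S a b) = (\<Sum>b<a. S a b) + (\<Sum>b\<in>{a..n}. S a b)" if "a \<le> Suc n" for a
      using that by (subst sum.union_disjoint[symmetric]) (auto intro!: sum.cong)
    then show ?thesis by (simp add: sum.distrib)
  qed
  also have "(\<Sum>a\<le>Suc n. \<Sum>b<a. S a b) = - (\<Sum>j\<le>Suc n. \<Sum>i<j. T i j)"
    by (simp add: low sum_negf)
  also have "(\<Sum>a\<le>n. \<Sum>b\<in>{a..n}. S a b) = - (\<Sum>j\<le>Suc n. \<Sum>i<j. T i j)"
  proof -
    have "(\<Sum>a\<le>n. \<Sum>b\<in>{a..n}. S a b) = (\<Sum>a\<le>n. \<Sum>b\<in>{a..n}. - T a (Suc b))"
      by (simp add: high)
    also have "\<dots> = (\<Sum>b\<le>n. \<Sum>a\<le>b. - T a (Suc b))"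
      unfolding sum.Sigma[OF finite_atMost ballI[OF finite_atMost]]
        sum.Sigma[OF finite_atMost ballI[OF finite_atLeastAtMost]]
      by (rule sum.reindex_bij_witness[of _ "\<lambda>(b, a). (a, b)" "\<lambda>(a, b). (b, a)"]) auto
    also have "\<dots> = - (\<Sum>j\<le>Suc n. \<Sum>i<j. T i j)"
      by (simp add: sum.atMost_Suc_shift sum_negf lessThan_Suc_atMost del: sum.atMost_Suc)
    finally show ?thesis .
  qed
  finally have key: "(\<Sum>a\<le>Suc n. \<Sum>b\<le>n. S a b) = - scale 2 (\<Sum>j\<le>Suc n. \<Sum>i<j. T i j)"
    using scale_left_distrib[of 1 1 "\<Sum>j\<le>Suc n. \<Sum>i<j. T i j"] by (simp del: sum.atMost_Suc)
  have "alternation (Suc (Suc n)) (\<lambda>y. H (y 0) (y 1) (y \<circ> Suc \<circ> Suc)) x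
      = (\<Sum>a\<le>Suc n. scale (fact n) (\<Sum>b\<le>n. S a b))"
    by (subst alternation_Suc, subst inner) (simp add: S_def scale_sum_right mult.left_commute mult.commute)
  also have "\<dots> = - scale (2 * fact n) (\<Sum>j\<le>Suc n. \<Sum>i<j. T i j)"
    unfolding scale_sum_right[symmetric] key by (simp add: mult.commute)
  finally show ?thesis by (simp add: T_def)
qed

text \<open>
  A function that is skew in each of the two blocks is constant up to sign on the cosets represented by the shuffles,
  and each coset has \<open>m! n!\<close> elements.
\<close>

lemma alternation_shuffle:
  assumes low: "\<And>\<tau> x. \<tau> permutes {..<m} \<Longrightarrow> f (x \<circ> \<tau>) = scale (of_int (sign \<tau>)) (f x)"
    and high: "\<And>\<rho> x. \<rho> permutes {..<n} \<Longrightarrow> f (x \<circ> shift_perm m \<rho>) = scale (of_int (sign \<rho>)) (f x)"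
  shows "alternation (m + n) f x =
    scale (fact m * fact n) (\<Sum>\<sigma>\<in>shuffle_perms m n. scale (of_int (sign \<sigma>)) (f (x \<circ> \<sigma>)))"
proof -
  have "alternation (m + n) f x = (\<Sum>(\<sigma>, \<tau>, \<rho>)\<in>shuffle_perms m n \<times> {\<tau>. \<tau> permutes {..<m}} \<times> {\<rho>. \<rho> permutes {..<n}}.
      scale (of_int (sign (\<sigma> \<circ> (\<tau> \<circ> shift_perm m \<rho>)))) (f (x \<circ> (\<sigma> \<circ> (\<tau> \<circ> shift_perm m \<rho>)))))"
    unfolding alternation_def
    by (subst sum.reindex_bij_betw[OF bij_betw_shuffles_times_blocks, symmetric]) (simp add: case_prod_beta)
  also have "\<dots> = (\<Sum>(\<sigma>, \<tau>, \<rho>)\<in>shuffle_perms m n \<times> {\<tau>. \<tau> permutes {..<m}} \<times> {\<rho>. \<rho> permutes {..<n}}.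
      scale (of_int (sign \<sigma>)) (f (x \<circ> \<sigma>)))"
  proof (intro sum.cong refl, clarify)
    fix \<sigma> \<tau> \<rho> assume s: "\<sigma> \<in> shuffle_perms m n" and t: "\<tau> permutes {..<m}" and r: "\<rho> permutes {..<n}"
    have s': "\<sigma> permutes {..<m + n}" using s by (simp add: shuffle_perms_def)
    have sg: "sign (\<tau> \<circ> shift_perm m \<rho>) = sign \<tau> * sign \<rho>"
      using sign_compose_permutes[OF t shift_perm_permutes[OF r]] sign_shift_perm[OF r] by simp
    have "\<tau> \<circ> shift_perm m \<rho> permutes {..<m + n}"
      by (intro permutes_compose permutes_subset[OF t] permutes_subset[OF shift_perm_permutes[OF r]]) auto
    then have sg': "sign (\<sigma> \<circ> (\<tau> \<circ> shift_perm m \<rho>)) = sign \<sigma> * (sign \<tau> * sign \<rho>)"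
      using sign_compose_permutes[OF s'] sg by simp
    have "f (x \<circ> (\<sigma> \<circ> (\<tau> \<circ> shift_perm m \<rho>))) = f (x \<circ> \<sigma> \<circ> \<tau> \<circ> shift_perm m \<rho>)"
      by (simp add: o_assoc)
    also have "\<dots> = scale (of_int (sign \<rho>)) (scale (of_int (sign \<tau>)) (f (x \<circ> \<sigma>)))"
      by (simp only: high[OF r] low[OF t])
    finally show "scale (of_int (sign (\<sigma> \<circ> (\<tau> \<circ> shift_perm m \<rho>)))) (f (x \<circ> (\<sigma> \<circ> (\<tau> \<circ> shift_perm m \<rho>))))
      = scale (of_int (sign \<sigma>)) (f (x \<circ> \<sigma>))"
      unfolding sg' by (simp add: sign_def)
  qed
  also have "\<dots> = scale (fact m * fact n) (\<Sum>\<sigma>\<in>shuffle_perms m n. scale (of_int (sign \<sigma>)) (f (x \<circ> \<sigma>)))"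
    by (simp add: sum.cartesian_product[symmetric] sum_constant_scale card_permutes_lessThan card_cartesian_product
      scale_sum_right mult.commute)
  finally show ?thesis .
qed

end

sublocale hom_lie_algebra \<subseteq> char_0_vector_space scale ..

section \<open>Linearity and skew functions\<close>

context char_0_vector_space
begin

lemma linearI:
  assumes "\<And>u v. f (u + v) = f u + f v" "\<And>c v. f (scale c v) = scale c (f v)"
  shows "Vector_Spaces.linear scale scale f"
  by (simp add: Vector_Spaces.linear_iff assms vector_space_axioms)

lemma linearD:
  assumes "Vector_Spaces.linear scale scale f"
  shows "f (u + v) = f u + f v" "f (scale c v) = scale c (f v)" "f (- v) = - f v"
    "f (u - v) = f u - f v" "f 0 = 0" "f (sum g I) = (\<Sum>i\<in>I. f (g i))"
proof -
  interpret module_hom scale scale f using assms by (simp add: module_hom_iff_linear)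
  show "f (u + v) = f u + f v" "f (scale c v) = scale c (f v)" "f (- v) = - f v"
    "f (u - v) = f u - f v" "f 0 = 0" "f (sum g I) = (\<Sum>i\<in>I. f (g i))"
    by (simp_all add: add scale neg diff sum)
qed

lemma linear_comp:
  assumes "Vector_Spaces.linear scale scale f" "Vector_Spaces.linear scale scale g"
  shows "Vector_Spaces.linear scale scale (\<lambda>v. f (g v))"
  by (rule linearI) (simp_all add: linearD(1,2)[OF assms(1)] linearD(1,2)[OF assms(2)])

lemma linear_alternation:
  assumes "Vector_Spaces.linear scale scale L"
  shows "L (alternation n F x) = alternation n (\<lambda>x. L (F x)) x"
  by (simp add: alternation_def linearD[OF assms])

text \<open>
  Transposing two equal entries changes nothing, so \<open>f x = - f x\<close>; in characteristic 0 this forces \<open>f x = 0\<close>.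
\<close>

lemma skew_repeated_zero:
  assumes "skew n f" "x i = x j" "i \<noteq> j" "i < n" "j < n"
  shows "f x = 0"
proof -
  have "x \<circ> transpose i j = x" using assms(2) by (auto simp: fun_eq_iff transpose_def)
  then have "f x = - f x"
    using skewD[OF assms(1) permutes_swap_id[of i _ j], of x] assms(3-5) by (simp add: sign_swap_id)
  then have "f x + f x = 0" by (simp only: eq_neg_iff_add_eq_0)
  then have "scale 2 (f x) = 0" using scale_left_distrib[of 1 1 "f x"] by simp
  then show ?thesis by simp
qed

text \<open>
  The factor \<open>n\<close> on the right makes the statement uniform: for \<open>n = 0\<close> there are no pairs.
\<close>

lemma signed_pair_sum_eq_alternation:
  assumes skew: "\<And>v w. skew (n - 1) (H v w)" and swap: "\<And>v w y. H v w y = - H w v y"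
  shows "scale (2 * fact n) (\<Sum>j\<le>n. \<Sum>i<j. scale ((-1) ^ (i + j)) (H (x i) (x j) (omit i (omit j x)))) =
    - scale (of_nat n) (alternation (Suc n) (\<lambda>y. H (y 0) (y 1) (y \<circ> Suc \<circ> Suc)) x)"
proof (cases n)
  case (Suc k)
  have "alternation (Suc (Suc k)) (\<lambda>y. H (y 0) (y 1) (y \<circ> Suc \<circ> Suc)) x =
    - scale (2 * fact k) (\<Sum>j\<le>Suc k. \<Sum>i<j. scale ((-1) ^ (i + j)) (H (x i) (x j) (omit i (omit j x))))"
    using skew Suc by (intro alternation_two_slots swap) simp
  then show ?thesis
    unfolding Suc by (simp add: mult.left_commute mult.commute del: sum.atMost_Suc of_nat_Suc)
next
  case 0
  show ?thesis unfolding 0 by simp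
qed

lemma skew_case_nat:
  assumes "skew (Suc n) f"
  shows "skew n (\<lambda>y. f (case_nat v y))"
  unfolding skew_def
proof (intro allI impI)
  fix \<sigma> y assume s: "\<sigma> permutes {..<n}"
  have eq: "case_nat v (y \<circ> \<sigma>) = case_nat v y \<circ> shift_perm 1 \<sigma>"
    by (auto simp: fun_eq_iff shift_perm_def split: nat.split)
  have "shift_perm 1 \<sigma> permutes {..<Suc n}"
    by (rule permutes_subset[OF shift_perm_permutes[OF s]]) auto
  then show "f (case_nat v (y \<circ> \<sigma>)) = scale (of_int (sign \<sigma>)) (f (case_nat v y))"
    unfolding eq by (simp only: skewD[OF assms] sign_shift_perm[OF s])
qed

lemma skew_comp: "skew n f \<Longrightarrow> skew n (\<lambda>y. f (g \<circ> y))"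
  by (simp add: skew_def o_assoc)

lemma skew_linear: "skew n f \<Longrightarrow> Vector_Spaces.linear scale scale L \<Longrightarrow> skew n (\<lambda>y. L (f y))"
  by (simp add: skew_def linearD(2)[of L])

lemma skew_add: "skew n f \<Longrightarrow> skew n g \<Longrightarrow> skew n (\<lambda>y. f y + g y)"
  by (simp add: skew_def scale_right_distrib)

text \<open>
  Permutations of the first \<open>k\<close> entries do not touch the entries from \<open>k\<close> on, so an
  alternation over the former may depend on the latter through \<open>K\<close>.
\<close>

lemma alternation_absorb_front:
  assumes "k \<le> N"
  shows "alternation N (\<lambda>x. alternation k (K (\<lambda>j. x (k + j))) (g \<circ> x)) x =
    scale (fact k) (alternation N (\<lambda>x. K (\<lambda>j. x (k + j)) (g \<circ> x)) x)"
proof -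
  have "alternation k (K (\<lambda>j. x (k + j))) (g \<circ> x) =
      (\<Sum>\<tau> | \<tau> permutes {..<k}. scale (of_int (sign \<tau>)) (K (\<lambda>j. (x \<circ> \<tau>) (k + j)) (g \<circ> (x \<circ> \<tau>))))" for x
    unfolding alternation_def by (intro sum.cong) (simp_all add: permutes_not_in o_assoc)
  then show ?thesis
    using assms alternation_absorb[where h = "\<lambda>\<tau>. \<tau>" and N = N and k = k and F = "\<lambda>x. K (\<lambda>j. x (k + j)) (g \<circ> x)"]
    by (auto intro: permutes_subset)
qed

lemma alternation_absorb_back:
  assumes "\<And>x x'. (\<And>i. i < s \<Longrightarrow> x i = x' i) \<Longrightarrow> K x = K x'"
  shows "alternation (s + k) (\<lambda>x. alternation k (K x) (\<lambda>j. x (s + j))) x =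
    scale (fact k) (alternation (s + k) (\<lambda>x. K x (\<lambda>j. x (s + j))) x)"
proof -
  have K: "K (x \<circ> shift_perm s \<tau>) = K x" for x \<tau>
    by (rule assms) (simp add: shift_perm_def)
  have "alternation k (K x) (\<lambda>j. x (s + j)) = (\<Sum>\<tau> | \<tau> permutes {..<k}.
      scale (of_int (sign \<tau>)) (K (x \<circ> shift_perm s \<tau>) (\<lambda>j. (x \<circ> shift_perm s \<tau>) (s + j))))" for x
    unfolding alternation_def K by (simp add: shift_perm_def comp_def)
  moreover have "shift_perm s \<tau> permutes {..<s + k}" if "\<tau> permutes {..<k}" for \<tau>
    by (rule permutes_subset[OF shift_perm_permutes[OF that]]) auto
  ultimately show ?thesis
    using alternation_absorb[where h = "shift_perm s" and N = "s + k" and k = k and F = "\<lambda>x. K x (\<lambda>j. x (s + j))"]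
    by (simp add: sign_shift_perm)
qed

text \<open>
  Each value of \<open>\<tau> 0\<close> is attained by \<open>d!\<close> permutations.
\<close>

lemma sum_permutations_at_0:
  "(\<Sum>\<tau> | \<tau> permutes {..<Suc d}. g (\<tau> 0)) = scale (fact d) (\<Sum>k\<le>d. g k)"
proof -
  have "(\<Sum>\<tau> | \<tau> permutes {..<Suc d}. g (\<tau> 0)) = (\<Sum>(i, \<tau>)\<in>{..d} \<times> {\<tau>. \<tau> permutes {..<d}}. g i)"
    by (subst sum.reindex_bij_betw[OF bij_betw_position_of_0, symmetric])
      (simp add: case_prod_beta cycle_to_front_def shift_perm_def)
  also have "\<dots> = scale (fact d) (\<Sum>k\<le>d. g k)"
    by (simp add: sum.cartesian_product[symmetric] sum_constant_scale card_permutes_lessThan scale_sum_right)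
  finally show ?thesis .
qed

end

section \<open>Cochains and the differential as alternations\<close>

context hom_lie_algebra
begin

lemmas bracket_left = linearD[OF bracket_linear_left]
lemmas bracket_right = linearD[OF bracket_linear_right]
lemmas alpha_simps = linearD[OF alpha_linear]

lemma alpha_power_linear: "Vector_Spaces.linear scale scale (\<alpha> ^^ k)"
  by (rule linearI; induction k) (simp_all add: alpha_simps)

lemma alpha_power_bracket: "(\<alpha> ^^ k) (bracket x y) = bracket ((\<alpha> ^^ k) x) ((\<alpha> ^^ k) y)"
  by (induction k) (simp_all add: multiplicative)

lemma alpha_alpha_power: "(\<alpha> ^^ k) (\<alpha> x) = \<alpha> ((\<alpha> ^^ k) x)"
  by (simp add: funpow_swap1)

lemma cochain_cong: "f \<in> cochains n \<Longrightarrow> (\<And>i. i < n \<Longrightarrow> x i = y i) \<Longrightarrow> f x = f y"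
  by (auto simp: cochains_def)

lemma cochain_linear: "f \<in> cochains n \<Longrightarrow> i < n \<Longrightarrow> Vector_Spaces.linear scale scale (\<lambda>v. f (x(i := v)))"
  by (auto simp: cochains_def)

lemma cochain_alpha: "f \<in> cochains n \<Longrightarrow> \<alpha> (f x) = f (\<alpha> \<circ> x)"
  by (auto simp: cochains_def)

lemma cochain_alpha_power: "f \<in> cochains n \<Longrightarrow> (\<alpha> ^^ k) (f x) = f ((\<alpha> ^^ k) \<circ> x)"
  by (induction k) (simp_all add: cochain_alpha o_assoc)

lemma cochain_linear_head:
  assumes "f \<in> cochains (Suc n)"
  shows "Vector_Spaces.linear scale scale (\<lambda>v. f (case_nat v y))"
proof -
  have "(case_nat 0 y)(0 := v) = case_nat v y" for v
    by (auto simp: fun_eq_iff split: nat.split)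
  then show ?thesis using cochain_linear[OF assms, of 0 "case_nat 0 y"] by simp
qed

text \<open>
  Polarisation: expand \<open>f\<close> at a tuple with \<open>x i + x j\<close> in both places.
\<close>

lemma cochain_transpose:
  assumes f: "f \<in> cochains n" and ij: "i < n" "j < n" "i \<noteq> j"
  shows "f (x \<circ> transpose i j) = - f x"
proof -
  define g where "g u v = f (x(i := u, j := v))" for u v
  have alt: "g u u = 0" for u
  proof -
    have "\<And>x i j. j < n \<Longrightarrow> i < j \<Longrightarrow> x i = x j \<Longrightarrow> f x = 0" using f by (auto simp: cochains_def)
    from this[of j i] this[of i j] show ?thesis using ij unfolding g_def by (cases "i < j") auto
  qed
  have right: "g u (v + w) = g u v + g u w" for u v w
    unfolding g_def using linearD(1)[OF cochain_linear[OF f ij(2)]] by simp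
  have left: "g (v + w) u = g v u + g w u" for u v w
    unfolding g_def fun_upd_twist[OF ij(3)] using linearD(1)[OF cochain_linear[OF f ij(1)]] by simp
  have "0 = g (x i + x j) (x i + x j)" by (simp add: alt)
  also have "\<dots> = g (x i) (x j) + g (x j) (x i)" unfolding left right by (simp add: alt)
  finally have "g (x j) (x i) = - g (x i) (x j)" by (simp add: eq_neg_iff_add_eq_0 add.commute)
  moreover have "g (x i) (x j) = f x" by (simp add: g_def)
  moreover have "g (x j) (x i) = f (x \<circ> transpose i j)"
    unfolding g_def by (rule arg_cong[where f = f]) (auto simp: fun_eq_iff transpose_def)
  ultimately show ?thesis by simp
qed

lemma cochain_skew:
  assumes f: "f \<in> cochains n"
  shows "skew n f"
  unfolding skew_def
proof (intro allI impI)
  fix \<sigma> x assume "\<sigma> permutes {..<n}"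
  then show "f (x \<circ> \<sigma>) = scale (of_int (sign \<sigma>)) (f x)"
    using finite_lessThan
  proof (induction arbitrary: x rule: permutes_induct)
    case (swap a b p)
    have "f (x \<circ> (transpose a b \<circ> p)) = scale (of_int (sign p)) (f (x \<circ> transpose a b))"
      by (simp only: o_assoc swap.IH)
    also have "\<dots> = scale (of_int (sign (transpose a b \<circ> p))) (f x)"
      using swap.hyps cochain_transpose[OF f, of a b x]
        sign_compose_permutes[OF permutes_swap_id[of a "{..<n}" b] swap.hyps(4)]
      by (simp add: sign_swap_id)
    finally show ?case .
  qed simp_all
qed

text \<open>
  Alternating any multilinear, \<open>\<alpha>\<close>-equivariant expression gives a cochain.
\<close>

lemma alternation_cochain:
  assumes cong: "\<And>x y. (\<And>i. i < N \<Longrightarrow> x i = y i) \<Longrightarrow> F x = F y"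
    and linear: "\<And>x i. i < N \<Longrightarrow> Vector_Spaces.linear scale scale (\<lambda>v. F (x(i := v)))"
    and alpha: "\<And>x. \<alpha> (F x) = F (\<alpha> \<circ> x)"
  shows "alternation N F \<in> cochains N"
  unfolding cochains_def
proof (intro CollectI conjI allI impI)
  fix x y :: "nat \<Rightarrow> 'g" assume "\<forall>i<N. x i = y i"
  then have "F (x \<circ> \<sigma>) = F (y \<circ> \<sigma>)" if "\<sigma> permutes {..<N}" for \<sigma>
    using permutes_in_image[OF that] by (intro cong) auto
  then show "alternation N F x = alternation N F y" by (simp add: alternation_def)
next
  fix x i assume i: "i < N"
  have lin: "Vector_Spaces.linear scale scale (\<lambda>v. F (x(i := v) \<circ> \<sigma>))" if s: "\<sigma> permutes {..<N}" for \<sigma>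
  proof -
    obtain j where j: "j < N" "\<sigma> j = i" using permutes_image[OF s] i by (metis imageE lessThan_iff)
    have "x(i := v) \<circ> \<sigma> = (x \<circ> \<sigma>)(j := v)" for v
      using j permutes_inj[OF s] by (auto simp: fun_eq_iff inj_eq)
    then show ?thesis using linear[OF j(1)] by simp
  qed
  show "Vector_Spaces.linear scale scale (\<lambda>v. alternation N F (x(i := v)))"
    by (rule linearI)
      (simp_all add: alternation_def linearD(1,2)[OF lin] scale_right_distrib sum.distrib scale_sum_right mult.commute)
next
  fix x :: "nat \<Rightarrow> 'g" and i j assume "j < N" "i < j" "x i = x j"
  then show "alternation N F x = 0" using skew_repeated_zero[OF skew_alternation, of x i j] by auto
next
  fix x show "\<alpha> (alternation N F x) = alternation N F (\<alpha> \<circ> x)"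
    by (simp add: alternation_def alpha_simps alpha o_assoc)
qed

text \<open>
  In this form \<open>\<delta> f\<close> can be absorbed into an outer alternation, and can itself absorb the alternation defining \<open>f\<close>.
\<close>

lemma differential_alternation:
  assumes f: "f \<in> cochains (Suc k)"
  shows "scale (2 * fact (Suc k)) (differential (Suc k) f x) =
    alternation (Suc (Suc k)) (\<lambda>z. scale 2 (bracket ((\<alpha> ^^ k) (z 0)) (f (z \<circ> Suc))) -
      scale (of_nat (Suc k)) (f (case_nat (bracket (z 0) (z 1)) (\<alpha> \<circ> (z \<circ> Suc \<circ> Suc))))) x"
proof -
  define G where "G v y = bracket ((\<alpha> ^^ k) v) (f y)" for v y
  define H where "H v w y = f (case_nat (bracket v w) (\<alpha> \<circ> y))" for v w y
  have skG: "skew (Suc k) (G v)" for v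
    unfolding G_def by (rule skew_linear[OF cochain_skew[OF f] bracket_linear_right])
  have skH: "skew (Suc k - 1) (H v w)" for v w
    unfolding H_def diff_Suc_1 by (rule skew_comp[OF skew_case_nat[OF cochain_skew[OF f]]])
  have sw: "H v w y = - H w v y" for v w y
    unfolding H_def by (subst bracket_skew) (simp add: linearD[OF cochain_linear_head[OF f]])
  have "differential (Suc k) f x = (\<Sum>i\<le>Suc k. scale ((-1) ^ i) (G (x i) (omit i x)))
     + (\<Sum>j\<le>Suc k. \<Sum>i<j. scale ((-1) ^ (i + j)) (H (x i) (x j) (omit i (omit j x))))"
    by (simp add: differential_def G_def H_def del: sum.atMost_Suc)
  then have "scale (2 * fact (Suc k)) (differential (Suc k) f x) =
     scale 2 (scale (fact (Suc k)) (\<Sum>i\<le>Suc k. scale ((-1) ^ i) (G (x i) (omit i x))))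
     + scale (2 * fact (Suc k)) (\<Sum>j\<le>Suc k. \<Sum>i<j. scale ((-1) ^ (i + j)) (H (x i) (x j) (omit i (omit j x))))"
    by (simp only: scale_right_distrib scale_scale)
  also have "\<dots> = scale 2 (alternation (Suc (Suc k)) (\<lambda>y. G (y 0) (y \<circ> Suc)) x)
     - scale (of_nat (Suc k)) (alternation (Suc (Suc k)) (\<lambda>y. H (y 0) (y 1) (y \<circ> Suc \<circ> Suc)) x)"
    by (simp only: alternation_one_slot[of "Suc k" G, OF skG] signed_pair_sum_eq_alternation[of "Suc k" H, OF skH sw] diff_conv_add_uminus)
  finally show ?thesis
    by (simp only: alternation_diff alternation_scale G_def H_def)
qed

text \<open>
  Separating the first entry \<open>v\<close> from the others. This is used with a value of \<open>Q\<close> in the place of \<open>v\<close>,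
  which must not be permuted with the other entries.
\<close>

lemma differential_contraction:
  "differential (Suc p) f (case_nat v y) = bracket ((\<alpha> ^^ p) v) (f y)
    - (\<Sum>j\<le>p. scale ((-1) ^ j) (bracket ((\<alpha> ^^ p) (y j)) (f (case_nat v (omit j y)))
        + f (case_nat (bracket v (y j)) (\<alpha> \<circ> omit j y))))
    + (\<Sum>j\<le>p. \<Sum>i<j. scale ((-1) ^ (i + j))
        (f (case_nat (bracket (y i) (y j)) (case_nat (\<alpha> v) (\<alpha> \<circ> omit i (omit j y))))))"
proof -
  have o0: "omit 0 (case_nat v y) = y" for v y by (simp add: omit_def)
  have oS: "omit (Suc j) (case_nat v y) = case_nat v (omit j y)" for j v y
    by (auto simp: omit_def fun_eq_iff split: nat.split)
  have al: "\<alpha> \<circ> case_nat v y = case_nat (\<alpha> v) (\<alpha> \<circ> y)" for v y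
    by (auto simp: fun_eq_iff split: nat.split)
  have first: "(\<Sum>i\<le>Suc p. scale ((-1) ^ i) (bracket ((\<alpha> ^^ p) (case_nat v y i)) (f (omit i (case_nat v y)))))
      = bracket ((\<alpha> ^^ p) v) (f y)
        - (\<Sum>j\<le>p. scale ((-1) ^ j) (bracket ((\<alpha> ^^ p) (y j)) (f (case_nat v (omit j y)))))"
    by (simp add: sum.atMost_Suc_shift o0 oS sum_negf del: sum.atMost_Suc)
  have second: "(\<Sum>j\<le>Suc p. \<Sum>i<j. scale ((-1) ^ (i + j))
        (f (case_nat (bracket (case_nat v y i) (case_nat v y j)) (\<alpha> \<circ> omit i (omit j (case_nat v y))))))
      = (\<Sum>j\<le>p. (\<Sum>i<j. scale ((-1) ^ (i + j))
            (f (case_nat (bracket (y i) (y j)) (case_nat (\<alpha> v) (\<alpha> \<circ> omit i (omit j y))))))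
        - scale ((-1) ^ j) (f (case_nat (bracket v (y j)) (\<alpha> \<circ> omit j y))))"
    by (simp add: sum.atMost_Suc_shift sum.lessThan_Suc_shift o0 oS al del: sum.atMost_Suc sum.lessThan_Suc)
  have regroup: "a - b + (d - c) = a - (b + c) + d" for a b c d :: 'g
    by simp
  show ?thesis
    unfolding differential_def diff_Suc_1 first second sum_subtractf scale_right_distrib sum.distrib
    by (rule regroup)
qed

lemma differential_contraction_alternation:
  assumes f: "f \<in> cochains (Suc p)"
  shows "scale (2 * fact p) (differential (Suc p) f (case_nat v y)) =
    scale (2 * fact p) (bracket ((\<alpha> ^^ p) v) (f y))
    - scale 2 (alternation (Suc p) (\<lambda>y. bracket ((\<alpha> ^^ p) (y 0)) (f (case_nat v (y \<circ> Suc)))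
        + f (case_nat (bracket v (y 0)) (\<alpha> \<circ> (y \<circ> Suc)))) y)
    - scale (of_nat p) (alternation (Suc p)
        (\<lambda>y. f (case_nat (bracket (y 0) (y 1)) (case_nat (\<alpha> v) (\<alpha> \<circ> (y \<circ> Suc \<circ> Suc))))) y)"
proof -
  define G where "G w z = bracket ((\<alpha> ^^ p) w) (f (case_nat v z)) + f (case_nat (bracket v w) (\<alpha> \<circ> z))" for w z
  define H where "H w w' z = f (case_nat (bracket w w') (case_nat (\<alpha> v) (\<alpha> \<circ> z)))" for w w' z
  have sk: "skew (Suc p) f" by (rule cochain_skew[OF f])
  have skG: "skew p (G w)" for w
    unfolding G_def
    by (rule skew_add[OF skew_linear[OF skew_case_nat[OF sk] bracket_linear_right] skew_comp[OF skew_case_nat[OF sk]]])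
  have sw: "H w w' z = - H w' w z" for w w' z
    unfolding H_def by (subst bracket_skew) (simp add: linearD[OF cochain_linear_head[OF f]])
  have pair: "scale (2 * fact p) (\<Sum>j\<le>p. \<Sum>i<j. scale ((-1) ^ (i + j)) (H (y i) (y j) (omit i (omit j y)))) =
    - scale (of_nat p) (alternation (Suc p) (\<lambda>y. H (y 0) (y 1) (y \<circ> Suc \<circ> Suc)) y)"
  proof (cases p)
    case (Suc p')
    have "skew (p - 1) (H w w')" for w w'
      unfolding H_def Suc diff_Suc_1 by (rule skew_comp[OF skew_case_nat[OF skew_case_nat[OF sk[unfolded Suc]]]])
    then show ?thesis by (rule signed_pair_sum_eq_alternation) (rule sw)
  qed simp
  have "differential (Suc p) f (case_nat v y) = bracket ((\<alpha> ^^ p) v) (f y)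
    - (\<Sum>j\<le>p. scale ((-1) ^ j) (G (y j) (omit j y)))
    + (\<Sum>j\<le>p. \<Sum>i<j. scale ((-1) ^ (i + j)) (H (y i) (y j) (omit i (omit j y))))"
    unfolding differential_contraction G_def H_def ..
  then have "scale (2 * fact p) (differential (Suc p) f (case_nat v y)) =
    scale (2 * fact p) (bracket ((\<alpha> ^^ p) v) (f y))
    - scale 2 (scale (fact p) (\<Sum>j\<le>p. scale ((-1) ^ j) (G (y j) (omit j y))))
    + scale (2 * fact p) (\<Sum>j\<le>p. \<Sum>i<j. scale ((-1) ^ (i + j)) (H (y i) (y j) (omit i (omit j y))))"
    by (simp only: scale_right_distrib scale_right_diff_distrib scale_scale)
  then show ?thesis
    unfolding alternation_one_slot[of p G, OF skG, symmetric] pair by (simp add: G_def H_def)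
qed

lemma differential_scale: "differential n (\<lambda>x. scale c (f x)) x = scale c (differential n f x)"
  by (simp add: differential_def bracket_right scale_right_distrib scale_sum_right mult.commute)

lemma differential_add: "differential n (\<lambda>x. f x + g x) x = differential n f x + differential n g x"
  by (simp add: differential_def bracket_right scale_right_distrib sum.distrib)

end

section \<open>Substituting one cocycle into another\<close>

text \<open>
  Cocycles of positive degrees \<open>p + 1\<close> and \<open>q + 1\<close>; the powers of \<open>\<alpha>\<close> in the differential and in the bracket
  are then \<open>\<alpha>\<^sup>p\<close> and \<open>\<alpha>\<^sup>q\<close>.
\<close>

locale hom_lie_cocycle_pair = hom_lie_algebra scale bracket \<alpha>
  for scale :: "'k::field_char_0 \<Rightarrow> 'g::ab_group_add \<Rightarrow> 'g" and bracket and \<alpha> +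
  fixes p q :: nat and P Q :: "(nat \<Rightarrow> 'g) \<Rightarrow> 'g"
  assumes P: "P \<in> cocycles (Suc p)" and Q: "Q \<in> cocycles (Suc q)"
begin

text \<open>
  The value of \<open>Q\<close> is the first argument of \<open>P\<close>, but \<open>Q\<close> takes the last entries of the tuple. With this choice
  \<open>Q\<close> sits at the same entries \<open>x\<^sub>m, x\<^bsub>m + 1\<^esub>, \<dots>\<close> in the terms below as in the bracket, and hardly any
  sign appears.
\<close>

definition insert_first :: "(nat \<Rightarrow> 'g) \<Rightarrow> 'g" where
  "insert_first x = P (case_nat (Q (\<lambda>k. x (p + k))) ((\<alpha> ^^ q) \<circ> x))"

text \<open>
  The composition \<open>R\<close> whose differential is the bracket up to a constant. Alternating over all permutations rather
  than over shuffles multiplies it by \<open>p! (q + 1)!\<close>.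
\<close>

abbreviation insertion :: "(nat \<Rightarrow> 'g) \<Rightarrow> 'g" where
  "insertion \<equiv> alternation (Suc (p + q)) insert_first"

abbreviation alt :: "((nat \<Rightarrow> 'g) \<Rightarrow> 'g) \<Rightarrow> (nat \<Rightarrow> 'g) \<Rightarrow> 'g" where
  "alt \<equiv> alternation (Suc (Suc (p + q)))"

text \<open>
  The five expressions \<open>C\<close>, \<open>V\<close>, \<open>U\<close>, \<open>A\<close>, \<open>B\<close> to which all computations below reduce, in this order.
\<close>

definition cup_term where
  "cup_term x = bracket ((\<alpha> ^^ p) (Q (\<lambda>k. x (Suc p + k)))) (P ((\<alpha> ^^ q) \<circ> x))"

definition outer_term where
  "outer_term x = bracket ((\<alpha> ^^ (p + q)) (x 0)) (insert_first (x \<circ> Suc))"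

definition mixed_term where
  "mixed_term x = P (case_nat (bracket ((\<alpha> ^^ q) (x 0)) (Q (\<lambda>k. x (Suc p + k)))) (\<alpha> \<circ> ((\<alpha> ^^ q) \<circ> x \<circ> Suc)))"

definition in_Q_term where
  "in_Q_term x = P (case_nat (Q (case_nat (bracket (x 0) (x (Suc p))) (\<alpha> \<circ> (\<lambda>k. x (Suc (Suc (p + k))))))) (\<alpha> \<circ> ((\<alpha> ^^ q) \<circ> x \<circ> Suc)))"

definition in_P_term where
  "in_P_term x = P (case_nat (\<alpha> (Q (\<lambda>k. x (Suc p + k))))
     (case_nat ((\<alpha> ^^ q) (bracket (x 0) (x 1))) (\<alpha> \<circ> ((\<alpha> ^^ q) \<circ> x \<circ> Suc \<circ> Suc))))"

lemma P_cochain: "P \<in> cochains (Suc p)" and Q_cochain: "Q \<in> cochains (Suc q)"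
  and P_closed: "differential (Suc p) P x = 0" and Q_closed: "differential (Suc q) Q x = 0"
  using P Q by (auto simp: cocycles_def fun_eq_iff)

lemma P_cong_head:
  assumes "v = w" "\<And>i. i < p \<Longrightarrow> x i = y i"
  shows "P (case_nat v x) = P (case_nat w y)"
  by (rule cochain_cong[OF P_cochain]) (use assms in \<open>auto split: nat.split\<close>)

text \<open>
  Twisting the free arguments of \<open>P\<close> by a power of \<open>\<alpha>\<close> keeps the expression linear and \<open>\<alpha>\<close>-equivariant.
\<close>

lemma insertion_cochain: "insertion \<in> cochains (Suc (p + q))"
proof (rule alternation_cochain)
  fix x y :: "nat \<Rightarrow> 'g" assume xy: "\<And>i. i < Suc (p + q) \<Longrightarrow> x i = y i"
  have "Q (\<lambda>k. x (p + k)) = Q (\<lambda>k. y (p + k))"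
    by (rule cochain_cong[OF Q_cochain]) (simp add: xy)
  then show "insert_first x = insert_first y"
    unfolding insert_first_def by (rule P_cong_head) (simp add: xy)
next
  fix x and i assume i: "i < Suc (p + q)"
  show "Vector_Spaces.linear scale scale (\<lambda>v. insert_first (x(i := v)))"
  proof (cases "i < p")
    case True
    have "insert_first (x(i := v)) = P ((case_nat (Q (\<lambda>k. x (p + k))) ((\<alpha> ^^ q) \<circ> x))(Suc i := (\<alpha> ^^ q) v))" for v
      unfolding insert_first_def by (rule arg_cong[where f = P]) (use True in \<open>auto simp: fun_eq_iff split: nat.split\<close>)
    then show ?thesis
      using linear_comp[OF cochain_linear[OF P_cochain, of "Suc i"] alpha_power_linear] True by simp
  next
    case False
    then obtain j where j: "i = p + j" "j < Suc q" using i by (auto simp: not_less le_iff_add)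
    have "(\<lambda>k. (x(i := v)) (p + k)) = (\<lambda>k. x (p + k))(j := v)" for v
      by (auto simp: fun_eq_iff j)
    then have "insert_first (x(i := v)) = P (case_nat (Q ((\<lambda>k. x (p + k))(j := v))) ((\<alpha> ^^ q) \<circ> x))" for v
      unfolding insert_first_def by (intro P_cong_head) (use False in auto)
    then show ?thesis
      using linear_comp[OF cochain_linear_head[OF P_cochain] cochain_linear[OF Q_cochain j(2)]] by simp
  qed
next
  fix x
  have "\<alpha> \<circ> case_nat (Q (\<lambda>k. x (p + k))) ((\<alpha> ^^ q) \<circ> x) =
      case_nat (Q (\<lambda>k. (\<alpha> \<circ> x) (p + k))) ((\<alpha> ^^ q) \<circ> (\<alpha> \<circ> x))"
    by (auto simp: fun_eq_iff cochain_alpha[OF Q_cochain] comp_def alpha_alpha_power split: nat.split)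
  then show "\<alpha> (insert_first x) = insert_first (\<alpha> \<circ> x)"
    by (simp only: insert_first_def cochain_alpha[OF P_cochain])
qed

text \<open>
  The entries below \<open>p\<close> are arguments of \<open>P\<close> and the others are arguments of \<open>Q\<close>; transpositions within
  either group change the sign.
\<close>

lemma insert_first_transpose:
  assumes "(a < p \<and> b < p) \<or> (p \<le> a \<and> a < Suc (p + q) \<and> p \<le> b \<and> b < Suc (p + q))"
  shows "insert_first (x \<circ> transpose a b) = scale (of_int (sign (transpose a b))) (insert_first x)"
proof (cases "a < p \<and> b < p")
  case True
  have "case_nat (Q (\<lambda>k. (x \<circ> transpose a b) (p + k))) ((\<alpha> ^^ q) \<circ> (x \<circ> transpose a b))
      = case_nat (Q (\<lambda>k. x (p + k))) ((\<alpha> ^^ q) \<circ> x) \<circ> transpose (Suc a) (Suc b)"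
    using True by (auto simp: fun_eq_iff transpose_def split: nat.split)
  then show ?thesis
    using skewD[OF cochain_skew[OF P_cochain] permutes_swap_id[of "Suc a" _ "Suc b"]] True
    by (simp add: insert_first_def sign_swap_id)
next
  case False
  then obtain c d where cd: "a = p + c" "b = p + d" "c < Suc q" "d < Suc q"
    using assms by (auto simp: le_iff_add)
  have "(\<lambda>k. (x \<circ> transpose a b) (p + k)) = (\<lambda>k. x (p + k)) \<circ> transpose c d"
    by (auto simp: fun_eq_iff transpose_def cd)
  then have "Q (\<lambda>k. (x \<circ> transpose a b) (p + k)) = scale (of_int (sign (transpose a b))) (Q (\<lambda>k. x (p + k)))"
    using skewD[OF cochain_skew[OF Q_cochain] permutes_swap_id[of c _ d]] cd by (simp add: sign_swap_id)
  then have "insert_first (x \<circ> transpose a b) =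
      P (case_nat (scale (of_int (sign (transpose a b))) (Q (\<lambda>k. x (p + k)))) ((\<alpha> ^^ q) \<circ> x))"
    unfolding insert_first_def by (intro P_cong_head) (use cd in \<open>auto simp: transpose_def\<close>)
  then show ?thesis by (simp only: insert_first_def linearD(2)[OF cochain_linear_head[OF P_cochain]])
qed

text \<open>
  Evaluate \<open>\<delta>P = 0\<close> at \<open>(Q (x\<^sub>m, \<dots>), \<alpha>\<^sup>q x\<^sub>0, \<dots>, \<alpha>\<^sup>q x\<^sub>p)\<close> and alternate. The bracket of the first
  argument with the value of \<open>P\<close> gives \<open>C\<close>, the bracket of another argument with a value of \<open>P\<close> gives \<open>V\<close>,
  and the brackets of two arguments give \<open>U\<close> or \<open>B\<close> according to whether the first argument is
  one of the two.
\<close>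

lemma alternation_P_closed:
  "scale (2 * fact p) (alt cup_term x) - scale (2 * fact (Suc p)) (alt outer_term x)
    + scale (2 * fact (Suc p)) (alt mixed_term x)
    + scale (of_nat p * fact (Suc p)) (alt in_P_term x) = 0"
proof -
  define K where "K v y = bracket ((\<alpha> ^^ p) (y 0)) (P (case_nat v (y \<circ> Suc)))
      + P (case_nat (bracket v (y 0)) (\<alpha> \<circ> (y \<circ> Suc)))" for v y
  define L where "L v y = P (case_nat (bracket (y 0) (y 1)) (case_nat (\<alpha> v) (\<alpha> \<circ> (y \<circ> Suc \<circ> Suc))))" for v y
  let ?v = "\<lambda>x. Q (\<lambda>j. x (Suc p + j))" and ?y = "\<lambda>x. (\<alpha> ^^ q) \<circ> x"
  have P_neg: "P (case_nat (- v) y) = - P (case_nat v y)" for v y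
    by (rule linearD[OF cochain_linear_head[OF P_cochain]])
  have K: "K (?v x) (?y x) = outer_term x - mixed_term x" for x
  proof -
    have "bracket (?v x) ((\<alpha> ^^ q) (x 0)) = - bracket ((\<alpha> ^^ q) (x 0)) (?v x)"
      by (rule bracket_skew)
    then show ?thesis
      unfolding K_def outer_term_def mixed_term_def insert_first_def by (simp add: P_neg funpow_add o_assoc)
  qed
  have L: "scale (of_nat p) (L (?v x) (?y x)) = - scale (of_nat p) (in_P_term x)" for x
  proof (cases p)
    case (Suc p')
    have "L (?v x) (?y x) = - in_P_term x"
    proof -
      let ?z = "case_nat (\<alpha> (?v x)) (case_nat (bracket ((\<alpha> ^^ q) (x 0)) ((\<alpha> ^^ q) (x 1))) (\<alpha> \<circ> ((\<alpha> ^^ q) \<circ> x \<circ> Suc \<circ> Suc)))"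
      have "L (?v x) (?y x) = P (?z \<circ> transpose 0 1)"
        unfolding L_def by (rule arg_cong[where f = P]) (auto simp: fun_eq_iff transpose_def split: nat.split)
      also have "\<dots> = - P ?z"
        using Suc by (intro cochain_transpose[OF P_cochain]) auto
      finally show ?thesis by (simp add: in_P_term_def alpha_power_bracket)
    qed
    then show ?thesis by simp
  qed simp
  have "0 = scale (2 * fact p) (cup_term x) - scale 2 (alternation (Suc p) (K (?v x)) (?y x))
      - scale (of_nat p) (alternation (Suc p) (L (?v x)) (?y x))" for x
    using differential_contraction_alternation[OF P_cochain, of "?v x" "?y x"]
    unfolding P_closed scale_zero_right cup_term_def K_def[abs_def] L_def[abs_def] .
  then have "alt (\<lambda>x. 0) x = alt (\<lambda>x. scale (2 * fact p) (cup_term x)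
      - scale 2 (alternation (Suc p) (K (?v x)) (?y x))
      - scale (of_nat p) (alternation (Suc p) (L (?v x)) (?y x))) x"
    by (simp only:)
  also have "\<dots> = scale (2 * fact p) (alt cup_term x)
      - scale 2 (scale (fact (Suc p)) (alt (\<lambda>x. K (?v x) (?y x)) x))
      - scale (of_nat p) (scale (fact (Suc p)) (alt (\<lambda>x. L (?v x) (?y x)) x))"
    unfolding alternation_diff alternation_scale
    using alternation_absorb_front[where k = "Suc p" and N = "Suc (Suc (p + q))" and g = "\<alpha> ^^ q" and K = "\<lambda>t. K (Q t)"]
      alternation_absorb_front[where k = "Suc p" and N = "Suc (Suc (p + q))" and g = "\<alpha> ^^ q" and K = "\<lambda>t. L (Q t)"]
    by simp
  also have "scale (of_nat p) (scale (fact (Suc p)) (alt (\<lambda>x. L (?v x) (?y x)) x))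
      = scale (fact (Suc p)) (alt (\<lambda>x. scale (of_nat p) (L (?v x) (?y x))) x)"
    by (simp only: alternation_scale scale_scale mult.commute)
  also have "\<dots> = - scale (of_nat p * fact (Suc p)) (alt in_P_term x)"
    by (simp only: L alternation_minus alternation_scale scale_minus_right scale_scale mult.commute)
  finally show ?thesis
    by (simp only: K alternation_diff alternation_zero scale_right_diff_distrib scale_scale) (simp add: algebra_simps)
qed

text \<open>
  Substitute \<open>\<delta>Q = 0\<close>, evaluated at the entries from \<open>p\<close> on, into the first argument of \<open>P\<close> and alternate.
\<close>

lemma alternation_Q_closed:
  "scale 2 (alt mixed_term x) = scale (of_nat (Suc q)) (alt in_Q_term x)"
proof -
  define K where "K x z = P (case_nat (scale 2 (bracket ((\<alpha> ^^ q) (z 0)) (Q (z \<circ> Suc))) -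
      scale (of_nat (Suc q)) (Q (case_nat (bracket (z 0) (z 1)) (\<alpha> \<circ> (z \<circ> Suc \<circ> Suc))))) (\<alpha> \<circ> ((\<alpha> ^^ q) \<circ> x)))" for x z
  let ?z = "\<lambda>x j. x (p + j)" and ?N = "p + Suc (Suc q)"
  have N: "Suc (Suc (p + q)) = ?N" by simp
  have lin: "Vector_Spaces.linear scale scale (\<lambda>v. P (case_nat v y))" for y
    by (rule cochain_linear_head[OF P_cochain])
  have "alternation (Suc (Suc q)) (K x) (?z x) = 0" for x
  proof -
    have "alternation (Suc (Suc q)) (K x) (?z x)
      = P (case_nat (scale (2 * fact (Suc q)) (differential (Suc q) Q (?z x))) (\<alpha> \<circ> ((\<alpha> ^^ q) \<circ> x)))"
      unfolding differential_alternation[OF Q_cochain] linear_alternation[OF lin] K_def ..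
    then show ?thesis by (simp add: Q_closed linearD(5)[OF lin])
  qed
  then have "0 = alternation ?N (\<lambda>x. alternation (Suc (Suc q)) (K x) (?z x)) x"
    by (simp add: alternation_zero)
  also have "\<dots> = scale (fact (Suc (Suc q))) (alternation ?N (\<lambda>x. K x (?z x)) x)"
  proof (rule alternation_absorb_back)
    fix x x' :: "nat \<Rightarrow> 'g" assume "\<And>i. i < p \<Longrightarrow> x i = x' i"
    then show "K x = K x'" unfolding K_def by (intro ext P_cong_head) auto
  qed
  finally have zero: "alt (\<lambda>x. K x (?z x)) x = 0"
    unfolding N by (simp del: fact_Suc)
  \<comment> \<open>The bracketed entry is \<open>x p\<close> here and \<open>x 0\<close> in \<open>U\<close> and \<open>A\<close>; both terms change by the same sign.\<close>
  let ?c = "cycle_to_front p"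
  have K: "K x (?z x) = scale 2 (mixed_term (x \<circ> ?c)) - scale (of_nat (Suc q)) (in_Q_term (x \<circ> ?c))" for x
  proof -
    have c: "?c 0 = p" "?c (Suc (p + k)) = Suc (p + k)" "?c (Suc (Suc (p + k))) = Suc (Suc (p + k))"
      "?c (Suc p) = Suc p" "i < p \<Longrightarrow> ?c (Suc i) = i" for k i
      by (simp_all add: cycle_to_front_def)
    have "mixed_term (x \<circ> ?c) = P (case_nat (bracket ((\<alpha> ^^ q) (?z x 0)) (Q (?z x \<circ> Suc))) (\<alpha> \<circ> ((\<alpha> ^^ q) \<circ> x)))"
      unfolding mixed_term_def by (rule P_cong_head) (simp_all add: c comp_def)
    moreover have "in_Q_term (x \<circ> ?c) =
        P (case_nat (Q (case_nat (bracket (?z x 0) (?z x 1)) (\<alpha> \<circ> (?z x \<circ> Suc \<circ> Suc)))) (\<alpha> \<circ> ((\<alpha> ^^ q) \<circ> x)))"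
      unfolding in_Q_term_def by (rule P_cong_head) (simp_all add: c comp_def)
    ultimately show ?thesis
      unfolding K_def by (simp only: linearD(2,4)[OF lin])
  qed
  have c: "?c permutes {..<Suc (Suc (p + q))}" by (rule cycle_to_front_permutes) simp
  have "scale (of_int (sign ?c)) (scale 2 (alt mixed_term x) - scale (of_nat (Suc q)) (alt in_Q_term x)) = 0"
    using zero unfolding K alternation_diff alternation_scale alternation_permute[OF c]
    by (simp add: scale_right_diff_distrib mult.commute)
  then show ?thesis by (simp add: sign_def split: if_splits)
qed

text \<open>
  The part of \<open>\<delta> R\<close> with brackets of two arguments. In each summand of \<open>R\<close> the bracket \<open>[x\<^sub>0, x\<^sub>1]\<close> lands either in one
  of the \<open>p\<close> free slots of \<open>P\<close> or in one of the \<open>q + 1\<close> slots of \<open>Q\<close>; after alternation the former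
  summands all agree with \<open>B\<close> and the latter with \<open>A\<close>.
\<close>

lemma alternation_insertion_bracket:
  "alt (\<lambda>x. insertion (case_nat (bracket (x 0) (x 1)) (\<alpha> \<circ> (x \<circ> Suc \<circ> Suc)))) x =
    scale (fact (p + q)) (scale (of_nat p) (alt in_P_term x) + scale (of_nat (Suc q)) (alt in_Q_term x))"
proof -
  define y where "y x = case_nat (bracket (x 0) (x 1)) (\<alpha> \<circ> (x \<circ> Suc \<circ> Suc))" for x
  let ?D = "Suc (p + q)"
  define g where "g k = (if k < p then alt in_P_term x else alt in_Q_term x)" for k
  \<comment> \<open>Permutations that fix the bracket come from permutations of the \<open>x\<^sub>j\<close> with \<open>j \<ge> 2\<close>, and are absorbed.\<close>
  have y_perm: "y x \<circ> \<rho> = y (x \<circ> shift_perm 1 \<rho>)" if "inj \<rho>" "\<rho> 0 = 0" for x \<rho>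
  proof
    fix j show "(y x \<circ> \<rho>) j = y (x \<circ> shift_perm 1 \<rho>) j"
    proof (cases j)
      case (Suc i)
      then have "\<rho> j \<noteq> 0" using injD[OF that(1), of j 0] that(2) by auto
      then obtain l where "\<rho> (Suc i) = Suc l" using Suc by (cases "\<rho> j") auto
      then show ?thesis unfolding Suc by (simp add: y_def shift_perm_def)
    qed (simp add: y_def shift_perm_def that)
  qed
  have alt_\<rho>: "alt (\<lambda>x. f (y x \<circ> \<rho>)) x = scale (of_int (sign \<rho>)) (alt (\<lambda>x. f (y x)) x)"
    if "\<rho> permutes {..<?D}" "\<rho> 0 = 0" for \<rho> f
  proof -
    have "shift_perm 1 \<rho> permutes {..<Suc ?D}"
      by (rule permutes_subset[OF shift_perm_permutes[OF that(1)]]) auto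
    then show ?thesis
      using alternation_permute[of "shift_perm 1 \<rho>" "Suc ?D" "\<lambda>x. f (y x)"]
      by (simp only: y_perm[OF permutes_inj[OF that(1)] that(2)] sign_shift_perm[OF that(1)])
  qed
  have each: "alt (\<lambda>x. insert_first (y x \<circ> \<tau>)) x = scale (of_int (sign \<tau>)) (g k)"
    if \<tau>: "\<tau> permutes {..<?D}" and k: "k < ?D" "\<tau> k = 0" for \<tau> k
  proof (cases "k < p")
    case True
    \<comment> \<open>Move the bracket from slot \<open>k\<close> of \<open>P\<close> to the first free slot.\<close>
    define \<rho> where "\<rho> = \<tau> \<circ> transpose 0 k"
    have t: "transpose 0 k permutes {..<?D}" using k by (intro permutes_swap_id) auto
    have \<rho>: "\<rho> permutes {..<?D}" unfolding \<rho>_def by (rule permutes_compose[OF t \<tau>])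
    have \<tau>_eq: "\<tau> = \<rho> \<circ> transpose 0 k" by (simp add: \<rho>_def o_assoc[symmetric])
    have sign: "sign \<tau> = sign \<rho> * sign (transpose 0 k)"
      using sign_compose_permutes[OF \<rho> t] \<tau>_eq by simp
    have y: "insert_first (y x) = in_P_term x" for x
    proof -
      have "Q (\<lambda>j. y x (p + j)) = \<alpha> (Q (\<lambda>k. x (Suc p + k)))"
        unfolding cochain_alpha[OF Q_cochain] using True
        by (intro arg_cong[where f = Q]) (auto simp: fun_eq_iff y_def split: nat.split)
      then show ?thesis unfolding in_P_term_def insert_first_def
        by (intro P_cong_head) (auto simp: y_def alpha_alpha_power split: nat.split)
    qed
    have "alt (\<lambda>x. insert_first (y x \<circ> \<tau>)) x
        = scale (of_int (sign (transpose 0 k))) (alt (\<lambda>x. insert_first (y x \<circ> \<rho>)) x)"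
      unfolding \<tau>_eq o_assoc using True by (simp add: insert_first_transpose alternation_scale)
    also have "\<dots> = scale (of_int (sign \<tau>)) (g k)"
      using True alt_\<rho>[OF \<rho>, of insert_first] k by (simp add: \<rho>_def y g_def sign mult.commute)
    finally show ?thesis .
  next
    case False
    \<comment> \<open>Move the bracket to the first slot of \<open>Q\<close>. Then \<open>transpose 0 p\<close> leaves \<open>\<alpha> x\<^bsub>p + 1\<^esub>\<close> in the first free
      slot of \<open>P\<close>, which \<open>transpose 1 (Suc p)\<close> corrects with the same sign, also when \<open>p = 0\<close>.\<close>
    define \<rho> where "\<rho> = \<tau> \<circ> transpose p k \<circ> transpose 0 p"
    have t: "transpose 0 p permutes {..<?D}" "transpose p k permutes {..<?D}"
      using k by (intro permutes_swap_id; auto)+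
    have \<rho>: "\<rho> permutes {..<?D}" unfolding \<rho>_def by (intro permutes_compose t \<tau>)
    have \<rho>0: "\<rho> 0 = 0" using k by (simp add: \<rho>_def)
    have \<tau>_eq: "\<tau> = \<rho> \<circ> transpose 0 p \<circ> transpose p k" by (simp add: \<rho>_def o_assoc[symmetric])
    have sign: "sign \<tau> = sign \<rho> * sign (transpose 0 p) * sign (transpose p k)"
      using sign_compose_permutes[OF \<rho> t(1)] sign_compose_permutes[OF permutes_compose[OF t(1) \<rho>] t(2)] \<tau>_eq
      by simp
    let ?t = "transpose 1 (Suc p)"
    have t': "?t permutes {..<Suc ?D}" by (intro permutes_swap_id) auto
    have y: "insert_first (y x \<circ> transpose 0 p) = in_Q_term (x \<circ> ?t)" for x
    proof -
      have "(\<lambda>j. (y x \<circ> transpose 0 p) (p + j)) = case_nat (bracket ((x \<circ> ?t) 0) ((x \<circ> ?t) (Suc p)))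
          (\<alpha> \<circ> (\<lambda>k. (x \<circ> ?t) (Suc (Suc (p + k)))))"
      proof
        fix j show "(y x \<circ> transpose 0 p) (p + j) = case_nat (bracket ((x \<circ> ?t) 0) ((x \<circ> ?t) (Suc p)))
          (\<alpha> \<circ> (\<lambda>k. (x \<circ> ?t) (Suc (Suc (p + k))))) j"
          by (cases j) (auto simp: y_def transpose_def)
      qed
      then show ?thesis unfolding in_Q_term_def insert_first_def
        by (intro P_cong_head) (auto simp: y_def transpose_def alpha_alpha_power split: nat.split)
    qed
    have "alt (\<lambda>x. insert_first (y x \<circ> \<tau>)) x
        = scale (of_int (sign (transpose p k))) (alt (\<lambda>x. insert_first (y x \<circ> \<rho> \<circ> transpose 0 p)) x)"
      unfolding \<tau>_eq o_assoc using False k by (simp add: insert_first_transpose alternation_scale)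
    also have "\<dots> = scale (of_int (sign (transpose p k))) (scale (of_int (sign \<rho>))
        (scale (of_int (sign ?t)) (alt in_Q_term x)))"
      using alt_\<rho>[OF \<rho> \<rho>0, of "\<lambda>z. insert_first (z \<circ> transpose 0 p)"] alternation_permute[OF t', of in_Q_term]
      by (simp only: y)
    also have "\<dots> = scale (of_int (sign \<tau>)) (g k)"
      using False by (simp add: sign g_def sign_swap_id mult.commute)
    finally show ?thesis .
  qed
  have "alt (\<lambda>x. insertion (y x)) x
      = (\<Sum>\<tau> | \<tau> permutes {..<?D}. scale (of_int (sign \<tau>)) (alt (\<lambda>x. insert_first (y x \<circ> \<tau>)) x))"
    by (simp only: alternation_def[of ?D insert_first] alternation_sum alternation_scale)
  also have "\<dots> = (\<Sum>\<tau> | \<tau> permutes {..<?D}. g (inv_into UNIV \<tau> 0))"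
  proof (rule sum.cong[OF refl])
    fix \<tau> assume "\<tau> \<in> {\<tau>. \<tau> permutes {..<?D}}"
    then have \<tau>: "\<tau> permutes {..<?D}" by simp
    have "inv_into UNIV \<tau> 0 < ?D"
      using permutes_in_image[OF permutes_inv[OF \<tau>], of 0] by simp
    then have "alt (\<lambda>x. insert_first (y x \<circ> \<tau>)) x = scale (of_int (sign \<tau>)) (g (inv_into UNIV \<tau> 0))"
      by (rule each[OF \<tau>]) (simp add: permutes_inverses[OF \<tau>])
    then show "scale (of_int (sign \<tau>)) (alt (\<lambda>x. insert_first (y x \<circ> \<tau>)) x) = g (inv_into UNIV \<tau> 0)"
      by simp
  qed
  also have "\<dots> = (\<Sum>\<tau> | \<tau> permutes {..<?D}. g (\<tau> 0))"
    by (rule sum_permutations_inverse[symmetric])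
  also have "\<dots> = scale (fact (p + q)) (\<Sum>k\<le>p + q. g k)"
    by (rule sum_permutations_at_0)
  also have "(\<Sum>k\<le>p + q. g k) = (\<Sum>k<p. g k) + (\<Sum>k=p..p + q. g k)"
    by (subst sum.union_disjoint[symmetric]) (auto intro!: sum.cong)
  also have "(\<Sum>k<p. g k) = scale (of_nat p) (alt in_P_term x)"
    by (simp add: g_def sum_constant_scale)
  also have "(\<Sum>k=p..p + q. g k) = scale (of_nat (Suc q)) (alt in_Q_term x)"
    by (simp add: g_def sum_constant_scale)
  finally show ?thesis by (simp add: y_def)
qed

text \<open>
  The part of \<open>\<delta> R\<close> in which an argument is bracketed with a value of \<open>R\<close> is \<open>V\<close>, and the other part is
  known from \<open>alternation_insertion_bracket\<close>. Closedness of \<open>Q\<close> then replaces \<open>A\<close> by \<open>U\<close>.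
\<close>

lemma differential_insertion:
  "scale 2 (differential (Suc (p + q)) insertion x) =
    scale 2 (alt outer_term x) - scale 2 (alt mixed_term x) - scale (of_nat p) (alt in_P_term x)"
proof -
  let ?D = "Suc (p + q)"
  have outer: "alt (\<lambda>z. bracket ((\<alpha> ^^ (p + q)) (z 0)) (insertion (z \<circ> Suc))) x
      = scale (fact ?D) (alt outer_term x)"
    using alternation_absorb_back[where s = 1 and k = ?D
        and K = "\<lambda>z y. bracket ((\<alpha> ^^ (p + q)) (z 0)) (insert_first y)" and x = x]
    unfolding linear_alternation[OF bracket_linear_right]
    by (simp add: outer_term_def[abs_def] comp_def del: fact_Suc)
  have fact: "of_nat ?D * fact (p + q) = (fact ?D :: 'k)" by simp
  have "scale (fact ?D) (scale 2 (differential ?D insertion x)) =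
     alt (\<lambda>z. scale 2 (bracket ((\<alpha> ^^ (p + q)) (z 0)) (insertion (z \<circ> Suc))) -
      scale (of_nat ?D) (insertion (case_nat (bracket (z 0) (z 1)) (\<alpha> \<circ> (z \<circ> Suc \<circ> Suc))))) x"
    using differential_alternation[OF insertion_cochain, of x] by (simp only: scale_scale mult.commute)
  also have "\<dots> = scale (fact ?D) (scale 2 (alt outer_term x)
      - (scale (of_nat p) (alt in_P_term x) + scale (of_nat (Suc q)) (alt in_Q_term x)))"
    unfolding alternation_diff alternation_scale outer alternation_insertion_bracket scale_scale fact
    by (simp only: scale_right_diff_distrib scale_scale mult.commute)
  finally have "scale 2 (differential ?D insertion x) = scale 2 (alt outer_term x)
      - (scale (of_nat p) (alt in_P_term x) + scale (of_nat (Suc q)) (alt in_Q_term x))"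
    by (rule scale_left_imp_eq[OF fact_nonzero])
  then show ?thesis unfolding alternation_Q_closed[symmetric] by (simp add: algebra_simps)
qed

text \<open>
  \<open>C\<close> is skew in the first \<open>p + 1\<close> and in the last \<open>q + 1\<close> entries, so its alternation reduces to
  shuffles. The minus sign comes from the order of the two factors in \<open>C\<close>.
\<close>

lemma alternation_cup_term:
  "alt cup_term x = - scale (fact (Suc p) * fact (Suc q)) (cup_bracket (Suc p) (Suc q) P Q x)"
proof -
  have "alternation (Suc p + Suc q) cup_term x = scale (fact (Suc p) * fact (Suc q))
      (\<Sum>\<sigma>\<in>shuffle_perms (Suc p) (Suc q). scale (of_int (sign \<sigma>)) (cup_term (x \<circ> \<sigma>)))"
  proof (rule alternation_shuffle)
    fix \<tau> and x :: "nat \<Rightarrow> 'g" assume \<tau>: "\<tau> permutes {..<Suc p}"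
    have "P ((\<alpha> ^^ q) \<circ> (x \<circ> \<tau>)) = scale (of_int (sign \<tau>)) (P ((\<alpha> ^^ q) \<circ> x))"
      using skewD[OF cochain_skew[OF P_cochain] \<tau>] by (simp only: o_assoc)
    moreover have "(\<lambda>k. (x \<circ> \<tau>) (Suc p + k)) = (\<lambda>k. x (Suc p + k))"
      by (simp add: permutes_not_in[OF \<tau>])
    ultimately show "cup_term (x \<circ> \<tau>) = scale (of_int (sign \<tau>)) (cup_term x)"
      by (simp only: cup_term_def bracket_right)
  next
    fix \<rho> and x :: "nat \<Rightarrow> 'g" assume \<rho>: "\<rho> permutes {..<Suc q}"
    have "(\<lambda>k. (x \<circ> shift_perm (Suc p) \<rho>) (Suc p + k)) = (\<lambda>k. x (Suc p + k)) \<circ> \<rho>"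
      by (simp add: shift_perm_def comp_def)
    moreover have "P ((\<alpha> ^^ q) \<circ> (x \<circ> shift_perm (Suc p) \<rho>)) = P ((\<alpha> ^^ q) \<circ> x)"
      by (rule cochain_cong[OF P_cochain]) (simp add: shift_perm_def)
    ultimately show "cup_term (x \<circ> shift_perm (Suc p) \<rho>) = scale (of_int (sign \<rho>)) (cup_term x)"
      by (simp only: cup_term_def skewD[OF cochain_skew[OF Q_cochain] \<rho>]
          linearD(2)[OF alpha_power_linear] bracket_left)
  qed
  moreover have "cup_term (x \<circ> \<sigma>) =
      - bracket ((\<alpha> ^^ q) (P (\<lambda>i. x (\<sigma> i)))) ((\<alpha> ^^ p) (Q (\<lambda>i. x (\<sigma> (Suc p + i)))))" for \<sigma>
    unfolding cup_term_def cochain_alpha_power[OF P_cochain] by (subst bracket_skew) (simp add: comp_def)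
  ultimately show ?thesis
    by (simp add: cup_bracket_def sum_negf)
qed

lemma cup_bracket_eq_differential:
  "cup_bracket (Suc p) (Suc q) P Q x =
    differential (Suc (p + q)) (\<lambda>x. scale (- (1 / (fact p * fact (Suc q)))) (insertion x)) x"
proof -
  let ?\<delta> = "differential (Suc (p + q)) insertion x" and ?cup = "cup_bracket (Suc p) (Suc q) P Q x"
  let ?c = "2 * fact p * fact (Suc p) * fact (Suc q) :: 'k"
  have regroup: "a - b + c + d = 0 \<Longrightarrow> a = b - c - d" for a b c d :: 'g
    by (simp add: algebra_simps add_eq_0_iff)
  have "scale (2 * fact p) (alt cup_term x) = scale (2 * fact (Suc p)) (alt outer_term x)
      - scale (2 * fact (Suc p)) (alt mixed_term x) - scale (of_nat p * fact (Suc p)) (alt in_P_term x)"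
    by (rule regroup[OF alternation_P_closed])
  also have "\<dots> = scale (fact (Suc p)) (scale 2 ?\<delta>)"
    unfolding differential_insertion by (simp only: scale_right_diff_distrib scale_scale mult.commute)
  finally have "- scale ?c ?cup = scale (fact (Suc p)) (scale 2 ?\<delta>)"
    unfolding alternation_cup_term by (simp add: mult.assoc del: fact_Suc)
  then have "scale ?c ?cup = - scale (fact (Suc p)) (scale 2 ?\<delta>)"
    by (metis minus_minus)
  also have "\<dots> = scale ?c (scale (- (1 / (fact p * fact (Suc q)))) ?\<delta>)"
    by (simp del: fact_Suc)
  finally have "?cup = scale (- (1 / (fact p * fact (Suc q)))) ?\<delta>"
    by (rule scale_left_imp_eq[of ?c, rotated]) (simp del: fact_Suc)
  then show ?thesis by (simp only: differential_scale)
qed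

end

section \<open>The class of the bracket\<close>

context hom_lie_algebra
begin

lemma cochains_scale: "f \<in> cochains n \<Longrightarrow> (\<lambda>x. scale c (f x)) \<in> cochains n"
proof -
  assume f: "f \<in> cochains n"
  have "Vector_Spaces.linear scale scale (\<lambda>v. scale c (f (x(i := v))))" if "i < n" for x i
    by (rule linearI) (simp_all add: linearD(1,2)[OF cochain_linear[OF f that]] scale_right_distrib mult.commute)
  moreover have "scale c (f x) = scale c (f y)" if "\<forall>i<n. x i = y i" for x y
    using that cochain_cong[OF f, of x y] by simp
  ultimately show ?thesis using f unfolding cochains_def by (simp add: alpha_simps)
qed

lemma cochains_add:
  assumes f: "f \<in> cochains n" and g: "g \<in> cochains n"
  shows "(\<lambda>x. f x + g x) \<in> cochains n"
proof -
  have "Vector_Spaces.linear scale scale (\<lambda>v. f (x(i := v)) + g (x(i := v)))" if "i < n" for x i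
    by (rule linearI) (simp_all add: linearD(1,2)[OF cochain_linear[OF f that]]
        linearD(1,2)[OF cochain_linear[OF g that]] scale_right_distrib)
  moreover have "f x + g x = f y + g y" if "\<forall>i<n. x i = y i" for x y
    using that cochain_cong[OF f, of x y] cochain_cong[OF g, of x y] by simp
  ultimately show ?thesis using f g unfolding cochains_def by (simp add: alpha_simps)
qed

text \<open>
  Coboundaries are closed under sums and differences, so translation by a coboundary permutes them.
\<close>

lemma coboundaries_coset:
  assumes "f \<in> coboundaries (Suc n)"
  shows "cohomology_class (Suc n) f = coboundaries (Suc n)"
proof -
  obtain b where b: "b \<in> cochains n" "f = differential n b"
    using assms by (auto simp: coboundaries_def)
  have "differential n a' \<in> (\<lambda>h x. h x + f x) ` differential n ` cochains n" if "a' \<in> cochains n" for a'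
  proof -
    have "differential n a' = (\<lambda>x. differential n (\<lambda>x. a' x + scale (-1) (b x)) x + f x)"
      by (simp only: differential_add differential_scale b(2)) (simp add: fun_eq_iff)
    moreover have "(\<lambda>x. a' x + scale (-1) (b x)) \<in> cochains n"
      by (intro cochains_add cochains_scale that b)
    ultimately show ?thesis by blast
  qed
  moreover have "(\<lambda>x. differential n a x + f x) \<in> differential n ` cochains n" if "a \<in> cochains n" for a
    using cochains_add[OF that b(1)] unfolding b(2) differential_add[symmetric] by blast
  ultimately have "(\<lambda>h x. h x + f x) ` differential n ` cochains n = differential n ` cochains n"
    by blast
  then show ?thesis
    by (auto simp: cohomology_class_def r_coset_def cocycle_group_def coboundaries_def)
qed

lemma cup_bracket_coboundary:
  assumes "m \<ge> 1" "n \<ge> 1" "P \<in> cocycles m" "Q \<in> cocycles n"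
  shows "cup_bracket m n P Q \<in> coboundaries (m + n)"
proof -
  obtain p q where mn: "m = Suc p" "n = Suc q" using assms(1,2) by (metis Suc_pred' less_eq_Suc_le One_nat_def)
  interpret hom_lie_cocycle_pair scale bracket \<alpha> p q P Q
    by unfold_locales (use assms mn in auto)
  have "cup_bracket m n P Q =
      differential (Suc (p + q)) (\<lambda>x. scale (- (1 / (fact p * fact (Suc q)))) (insertion x))"
    unfolding mn by (rule ext) (rule cup_bracket_eq_differential)
  moreover have "\<dots> \<in> differential (Suc (p + q)) ` cochains (Suc (p + q))"
    by (intro imageI cochains_scale insertion_cochain)
  moreover have "m + n = Suc (Suc (p + q))"
    by (simp add: mn)
  ultimately show ?thesis by (simp only: coboundaries_def nat.case)
qed

end

theorem theorem3p12:
  fixes scale :: "'k::field_char_0 \<Rightarrow> 'g::ab_group_add \<Rightarrow> 'g"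
    and bracket :: "'g \<Rightarrow> 'g \<Rightarrow> 'g" and \<alpha> :: "'g \<Rightarrow> 'g"
    and m n :: nat and P Q :: "(nat \<Rightarrow> 'g) \<Rightarrow> 'g"
  assumes "hom_lie_algebra scale bracket \<alpha>"
    and "m \<ge> 1" and "n \<ge> 1"
    and "P \<in> hom_lie_algebra.cocycles scale bracket \<alpha> m"
    and "Q \<in> hom_lie_algebra.cocycles scale bracket \<alpha> n"
  shows "hom_lie_algebra.cohomology_class scale bracket \<alpha> (m + n)
           (hom_lie_algebra.cup_bracket scale bracket \<alpha> m n P Q)
         = \<one>\<^bsub>hom_lie_algebra.cohomology scale bracket \<alpha> (m + n)\<^esub>"
proof -
  interpret hom_lie_algebra scale bracket \<alpha> by fact
  obtain k where k: "m + n = Suc k" using assms(2) by (cases "m + n") auto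
  have "cohomology_class (m + n) (cup_bracket m n P Q) = coboundaries (m + n)"
    using coboundaries_coset[of _ k] cup_bracket_coboundary[OF assms(2-5)] k by simp
  then show ?thesis by (simp add: cohomology_def)
qed

end
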